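(* Let $f=(f_1,\dots,f_n):X_0=\mathbf{A}^n\to Y_0=\mathbf{A}^n$ be a Keller map with a codimension one component $V$ of its finiteness variety, with associated $u$-$\gamma$ representation $\underline{x}:(u,\gamma_1,\dots,\gamma_{n-1})\mapsto(x_1,\dots,x_n)$ near a point $e$ over $v=0\in V$ (see context). Let $\hat f=f\circ\underline{x}$, also written $(f_1,\dots,f_n)$ as functions of $u,\gamma_1,\dots,\gamma_{n-1}$, and let $J(\hat f)$ be its Jacobian matrix with columns ordered $\gamma_1,\dots,\gamma_{n-1},u$ and $L=|J(\hat f)|$. For $1\le i\le n$ let $\gamma_j^i(r)$ and $u^i(r)$ denote the trajectories of $\gamma_j$ and $u$ for the system given by $f_i=r$ and $f_l=0$ for $l\neq i$. Then $$\sum_{j=1}^{n-1} \frac{\partial f_i}{\partial \gamma_j}\frac{d\gamma_j^i}{dr} + \frac{\partial f_i}{\partial u}\frac{du^i}{dr} = 1 .$$ In particular $$\frac{d\gamma_j^i}{dr} = L^{-1}J_j^i \quad (1\le j\le n-1)\qquad\text{and}\qquad \frac{du^{i}}{dr} = L^{-1}J_n^i,$$ where $J_l^i$ is the signed determinant (cofactor, sign $(-1)^{i+l}$) of $J(\hat f)$ with the $i$-th row and $l$-th column deleted.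
   Context: Work over $\mathbf{C}$. A Keller map is a polynomial map with Jacobian determinant identically $1$. The finiteness variety $V_f\subset Y_0$ is the set of points over which $f$ is not proper; $V$ is a codimension one irreducible component. $X=\mathbf{P}^n\supset X_0$. $\hat X\to X$ is a proper birational morphism with $\hat X$ smooth, and $\Gamma\subset\hat X$ is a prime divisor over the hyperplane at infinity such that $f$ extends to a rational map that is defined generically on $\Gamma$ and maps $\Gamma$ generically finitely and etale onto $V$ (as reduced varieties). The $u$-$\gamma$ representation near a generic $e\in\Gamma$: $\gamma_1,\dots,\gamma_{n-1}$ are local analytic parameters of $\Gamma$ at $e$, $m\geq 1$ is the order of vanishing of $1/x_1$ along $\Gamma$ (coordinates chosen so that $X_1\ne0$ at the image of $e$), $u^{m}=x_1$ for a chosen branch $u$, $(u^{-1},\gamma_1,\dots,\gamma_{n-1})$ are local analytic parameters of $\hat X$ at $e$, and $x_j=\sum_{i\ge0}X_i^j(\gamma_1,\dots,\gamma_{n-1})u^{m-i}$ with $X_i^j$ power series. For fixed $\gamma$, the point $x$ tends to the corresponding point of $\Gamma$ as $u\to\infty$. *)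

theory Defs
  imports "HOL-Analysis.Analysis" "HOL-Library.Extended_Nat" "Jordan_Normal_Form.Determinant"
begin

no_notation Matrix.vec_index (infixl "$" 100)
no_notation Matrix.scalar_prod (infix "\<bullet>" 70)
hide_const (open) Matrix.vec Determinants.det


section \<open>Polynomials, partial derivatives, holomorphic maps\<close>

inductive poly_fun :: "(complex^'n::finite \<Rightarrow> complex) \<Rightarrow> bool" where
  poly_const: "poly_fun (\<lambda>_. c)"
| poly_coord: "poly_fun (\<lambda>z. z $ k)"
| poly_add: "poly_fun P \<Longrightarrow> poly_fun Q \<Longrightarrow> poly_fun (\<lambda>z. P z + Q z)"
| poly_mult: "poly_fun P \<Longrightarrow> poly_fun Q \<Longrightarrow> poly_fun (\<lambda>z. P z * Q z)"

definition partial :: "(complex^'n \<Rightarrow> complex) \<Rightarrow> 'n \<Rightarrow> complex^'n \<Rightarrow> complex" where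
  "partial g k z = deriv (\<lambda>s. g (\<chi> l. if l = k then s else z $ l)) (z $ k)"

text \<open>The coordinates of \<open>complex^'n\<close> are numbered from \<open>0\<close> by a bijection
  \<open>ix :: nat \<Rightarrow> 'n\<close> on \<open>{..<CARD('n)}\<close>; \<open>ix (i - 1)\<close> is the \<open>i\<close>-th coordinate.  Shifting both
  indices by one does not change the sign \<open>(-1) ^ (i + l)\<close> in \<^const>\<open>cofactor\<close>.\<close>

definition jacobian :: "(nat \<Rightarrow> 'n::finite) \<Rightarrow> (complex^'n \<Rightarrow> complex^'n) \<Rightarrow> complex^'n \<Rightarrow> complex mat" where
  "jacobian ix g z =
     mat CARD('n) CARD('n) (\<lambda>(i, j). partial (\<lambda>w. g w $ ix i) (ix j) z)"

definition keller_map :: "(nat \<Rightarrow> 'n::finite) \<Rightarrow> (complex^'n \<Rightarrow> complex^'n) \<Rightarrow> bool" where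
  "keller_map ix f \<longleftrightarrow>
     (\<forall>k. poly_fun (\<lambda>z. f z $ k)) \<and> (\<forall>z. det (jacobian ix f z) = 1)"

definition holo_on :: "(complex^'a) set \<Rightarrow> (complex^'a \<Rightarrow> complex^'b) \<Rightarrow> bool" where
  "holo_on S G \<longleftrightarrow> open S \<and>
     (\<forall>z\<in>S. \<exists>G'. (G has_derivative G') (at z) \<and> (\<forall>c v. G' (c *s v) = c *s G' v))"


section \<open>Irreducibility and codimension in a topological space\<close>

definition irreducible_in :: "'a topology \<Rightarrow> 'a set \<Rightarrow> bool" where
  "irreducible_in T Z \<longleftrightarrow> Z \<subseteq> topspace T \<and> Z \<noteq> {} \<and>
     (\<forall>A B. closedin T A \<and> closedin T B \<and> Z \<subseteq> A \<union> B \<longrightarrow> Z \<subseteq> A \<or> Z \<subseteq> B)"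

definition irreducible_component :: "'a topology \<Rightarrow> 'a set \<Rightarrow> 'a set \<Rightarrow> bool" where
  "irreducible_component T S V \<longleftrightarrow> V \<subseteq> S \<and> irreducible_in T V \<and>
     (\<forall>W. irreducible_in T W \<and> V \<subseteq> W \<and> W \<subseteq> S \<longrightarrow> W = V)"

definition irreducible_chain :: "'a topology \<Rightarrow> nat \<Rightarrow> (nat \<Rightarrow> 'a set) \<Rightarrow> bool" where
  "irreducible_chain T k C \<longleftrightarrow>
     (\<forall>i\<le>k. closedin T (C i) \<and> irreducible_in T (C i)) \<and> (\<forall>i<k. C i \<subset> C (Suc i))"

definition krull_dim :: "'a topology \<Rightarrow> enat" where
  "krull_dim T = Sup {enat k |k. \<exists>C. irreducible_chain T k C}"

definition codimension :: "'a topology \<Rightarrow> 'a set \<Rightarrow> enat" where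
  "codimension T Z = Sup {enat k |k. \<exists>C. irreducible_chain T k C \<and> C 0 = Z}"

definition prime_divisor :: "'a topology \<Rightarrow> 'a set \<Rightarrow> bool" where
  "prime_divisor T Z \<longleftrightarrow> closedin T Z \<and> irreducible_in T Z \<and> codimension T Z = 1"


section \<open>Abstract complex varieties\<close>

text \<open>A (reduced, separated) variety is given by a finite cover by affine charts \<open>(U, \<phi>)\<close>, where
  \<open>\<phi>\<close> identifies \<open>U\<close> with a Zariski closed subset of an affine space.  All charts of an atlas use
  the same affine space \<open>complex^'k\<close>, which is no restriction since the cover is finite.\<close>

type_synonym ('a, 'k) atlas = "('a set \<times> ('a \<Rightarrow> complex^'k)) set"

definition zariski_closed :: "(complex^'k) set \<Rightarrow> bool" where
  "zariski_closed S \<longleftrightarrow> (\<exists>I. (\<forall>P\<in>I. poly_fun P) \<and> S = {z. \<forall>P\<in>I. P z = 0})"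

text \<open>A map \<open>h\<close> on \<open>S\<close> is regular if, in charts, it is near each point a quotient of polynomials.
  The clause \<open>h x \<in> V\<close> contains the Zariski continuity of \<open>h\<close>.\<close>

definition regular_map ::
  "('a, 'k::finite) atlas \<Rightarrow> 'a set \<Rightarrow> ('b, 'l::finite) atlas \<Rightarrow> ('a \<Rightarrow> 'b) \<Rightarrow> bool" where
  "regular_map A S B h \<longleftrightarrow>
     (\<forall>p\<in>S. \<exists>(V, \<psi>)\<in>B. h p \<in> V) \<and>
     (\<forall>p\<in>S. \<forall>(U, \<phi>)\<in>A. \<forall>(V, \<psi>)\<in>B. p \<in> U \<and> h p \<in> V \<longrightarrow>
        (\<exists>P Q. (\<forall>k. poly_fun (P k)) \<and> poly_fun Q \<and> Q (\<phi> p) \<noteq> 0 \<and>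
           (\<forall>x\<in>S \<inter> U. Q (\<phi> x) \<noteq> 0 \<longrightarrow>
              h x \<in> V \<and> \<psi> (h x) = (\<chi> k. P k (\<phi> x) / Q (\<phi> x)))))"

text \<open>Condition \<open>regular_map A X A (\<lambda>x. x)\<close> says that the overlaps are Zariski open with regular
  transition maps; the last condition is separatedness, i.e. the diagonal is closed.\<close>

definition variety :: "'a set \<Rightarrow> ('a, 'k::finite) atlas \<Rightarrow> bool" where
  "variety X A \<longleftrightarrow> finite A \<and> X = (\<Union>(U, \<phi>)\<in>A. U) \<and>
     (\<forall>(U, \<phi>)\<in>A. inj_on \<phi> U \<and> zariski_closed (\<phi> ` U)) \<and>
     regular_map A X A (\<lambda>x. x) \<and>
     (\<forall>(U, \<phi>)\<in>A. \<forall>(V, \<psi>)\<in>A. zariski_closed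
        ((\<lambda>x. (\<chi> s. case s of Inl k \<Rightarrow> \<phi> x $ k | Inr k \<Rightarrow> \<psi> x $ k) :: complex^('k + 'k)) ` (U \<inter> V)))"

definition zariski_top :: "'a set \<Rightarrow> ('a, 'k::finite) atlas \<Rightarrow> 'a topology" where
  "zariski_top X A =
     topology (\<lambda>W. W \<subseteq> X \<and> (\<forall>(U, \<phi>)\<in>A. zariski_closed (\<phi> ` (U - W))))"

definition classical_top :: "'a set \<Rightarrow> ('a, 'k::finite) atlas \<Rightarrow> 'a topology" where
  "classical_top X A =
     topology (\<lambda>W. W \<subseteq> X \<and> (\<forall>(U, \<phi>)\<in>A. openin (top_of_set (\<phi> ` U)) (\<phi> ` (U \<inter> W))))"

definition biregular ::
  "'a set \<Rightarrow> ('a, 'k::finite) atlas \<Rightarrow> 'b set \<Rightarrow> ('b, 'l::finite) atlas \<Rightarrow> 'a set \<Rightarrow> 'b set \<Rightarrow> ('a \<Rightarrow> 'b) \<Rightarrow> bool" where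
  "biregular X A Y B D E h \<longleftrightarrow>
     openin (zariski_top X A) D \<and> openin (zariski_top Y B) E \<and> bij_betw h D E \<and>
     regular_map A D B h \<and> regular_map B E A (the_inv_into D h)"

text \<open>Both sides are supposed to be irreducible, so that nonempty open sets are dense.\<close>

definition birational ::
  "'a set \<Rightarrow> ('a, 'k::finite) atlas \<Rightarrow> 'b set \<Rightarrow> ('b, 'l::finite) atlas \<Rightarrow> ('a \<Rightarrow> 'b) \<Rightarrow> bool" where
  "birational X A Y B h \<longleftrightarrow> (\<exists>D E. D \<noteq> {} \<and> biregular X A Y B D E h)"

definition exceptional_locus ::
  "'a set \<Rightarrow> ('a, 'k::finite) atlas \<Rightarrow> 'b set \<Rightarrow> ('b, 'l::finite) atlas \<Rightarrow> ('a \<Rightarrow> 'b) \<Rightarrow> 'a set" where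
  "exceptional_locus X A Y B h = {p \<in> X. \<nexists>D E. p \<in> D \<and> biregular X A Y B D E h}"

definition tangent_space :: "(complex^'k) set \<Rightarrow> complex^'k \<Rightarrow> (complex^'k) set" where
  "tangent_space S a =
     {v. \<forall>P. poly_fun P \<and> (\<forall>z\<in>S. P z = 0) \<longrightarrow> (\<Sum>k\<in>UNIV. partial P k a * v $ k) = 0}"

text \<open>For irreducible \<open>X\<close>, where the local dimension is the dimension at every point.\<close>

definition smooth_variety :: "'a set \<Rightarrow> ('a, 'k::finite) atlas \<Rightarrow> bool" where
  "smooth_variety X A \<longleftrightarrow>
     (\<forall>(U, \<phi>)\<in>A. \<forall>p\<in>U.
        enat (vec.dim (tangent_space (\<phi> ` U) (\<phi> p))) = krull_dim (zariski_top X A))"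

text \<open>Holomorphic maps between subsets of varieties: in charts, locally restrictions of
  holomorphic maps of the ambient affine spaces.  This is the structure of a reduced analytic
  space on \<open>S\<close> and \<open>T\<close>.\<close>

definition holomorphic_map ::
  "('a, 'k::finite) atlas \<Rightarrow> 'a set \<Rightarrow> ('b, 'l::finite) atlas \<Rightarrow> 'b set \<Rightarrow> ('a \<Rightarrow> 'b) \<Rightarrow> bool" where
  "holomorphic_map A S B T h \<longleftrightarrow> h ` S \<subseteq> T \<and>
     (\<forall>p\<in>S. \<forall>(U, \<phi>)\<in>A. \<forall>(V, \<psi>)\<in>B. p \<in> U \<and> h p \<in> V \<longrightarrow>
        (\<exists>O' G. \<phi> p \<in> O' \<and> holo_on O' G \<and>
           (\<forall>x\<in>S \<inter> U. \<phi> x \<in> O' \<longrightarrow> h x \<in> V \<and> \<psi> (h x) = G (\<phi> x))))"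

definition biholomorphic ::
  "('a, 'k::finite) atlas \<Rightarrow> 'a set \<Rightarrow> ('b, 'l::finite) atlas \<Rightarrow> 'b set \<Rightarrow> ('a \<Rightarrow> 'b) \<Rightarrow> bool" where
  "biholomorphic A S B T h \<longleftrightarrow> bij_betw h S T \<and>
     holomorphic_map A S B T h \<and> holomorphic_map B T A S (the_inv_into S h)"

text \<open>A morphism of complex varieties is etale at a point iff it is a local isomorphism of the
  associated analytic spaces there; \<open>S\<close> and \<open>T\<close> carry their reduced structures.\<close>

definition etale_at ::
  "'a set \<Rightarrow> ('a, 'k::finite) atlas \<Rightarrow> 'a set \<Rightarrow> 'b set \<Rightarrow> ('b, 'l::finite) atlas \<Rightarrow> 'b set \<Rightarrow>
   ('a \<Rightarrow> 'b) \<Rightarrow> 'a \<Rightarrow> bool" where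
  "etale_at X A S Y B T h p \<longleftrightarrow>
     (\<exists>P Q. p \<in> P \<and> openin (subtopology (classical_top X A) S) P \<and>
        openin (subtopology (classical_top Y B) T) Q \<and> biholomorphic A P B Q h)"


section \<open>Affine and projective space\<close>

definition affine_atlas :: "(complex^'n, 'n) atlas" where
  "affine_atlas = {(UNIV, \<lambda>z. z)}"

text \<open>Points of projective space are lines in \<open>complex^('n option)\<close>.  The homogeneous coordinate
  \<open>None\<close> is the one that vanishes at infinity, so \<open>x\<^sub>j = X\<^sub>j / X\<^sub>0\<close> reads
  \<open>homog l $ Some j / homog l $ None\<close>.  The choice in \<open>homog\<close> matters only up to a nonzero scalar.\<close>

type_synonym 'n line = "(complex^('n option)) set"

definition proj_space :: "'n::finite line set" where
  "proj_space = {vec.span {v} |v. v \<noteq> 0}"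

definition homog :: "'n::finite line \<Rightarrow> complex^('n option)" where
  "homog l = (SOME v. v \<in> l \<and> v \<noteq> 0)"

definition affine_part :: "'n::finite line \<Rightarrow> complex^'n" where
  "affine_part l = (\<chi> j. homog l $ Some j / homog l $ None)"

definition hyperplane_at_infinity :: "'n::finite line set" where
  "hyperplane_at_infinity = {l \<in> proj_space. homog l $ None = 0}"

definition proj_atlas :: "('n::finite line, 'n) atlas" where
  "proj_atlas =
     insert ({l \<in> proj_space. homog l $ None \<noteq> 0}, affine_part)
      (range (\<lambda>i. ({l \<in> proj_space. homog l $ Some i \<noteq> 0},
         \<lambda>l. \<chi> j. homog l $ (if j = i then None else Some j) / homog l $ Some i)))"


section \<open>The finiteness variety and the divisor over one of its components\<close>

definition finiteness_variety :: "(complex^'n \<Rightarrow> complex^'n) \<Rightarrow> (complex^'n) set" where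
  "finiteness_variety f =
     {y. \<not> (\<exists>W. open W \<and> y \<in> W \<and> proper_map (top_of_set (f -` W)) (top_of_set W) f)}"

definition codim_one_component :: "(complex^'n) set \<Rightarrow> (complex^'n) set \<Rightarrow> bool" where
  "codim_one_component S V \<longleftrightarrow>
     irreducible_component (zariski_top UNIV affine_atlas) S V \<and>
     codimension (zariski_top UNIV affine_atlas) V = 1"

text \<open>Properness of a morphism of complex varieties is properness for the classical topologies.\<close>

definition smooth_modification ::
  "'a set \<Rightarrow> ('a, 'k::finite) atlas \<Rightarrow> ('a \<Rightarrow> 'n::finite line) \<Rightarrow> bool" where
  "smooth_modification X A \<pi> \<longleftrightarrow>
     variety X A \<and> irreducible_in (zariski_top X A) X \<and> smooth_variety X A \<and>
     regular_map A X proj_atlas \<pi> \<and>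
     proper_map (classical_top X A) (classical_top proj_space proj_atlas) \<pi> \<and>
     birational X A proj_space proj_atlas \<pi>"

text \<open>\<open>F\<close>, regular on \<open>D\<close>, is the extension of \<open>f\<close> across the generic point of \<open>\<Gamma>\<close>; over the
  nonempty Zariski open part \<open>V'\<close> of \<open>V\<close> it is surjective, finite-to-one and etale on \<open>\<Gamma>\<close>.\<close>

definition extends_over_divisor ::
  "(complex^'n \<Rightarrow> complex^'n) \<Rightarrow> 'a set \<Rightarrow> ('a, 'k::finite) atlas \<Rightarrow> ('a \<Rightarrow> 'n::finite line) \<Rightarrow> 'a set \<Rightarrow>
   (complex^'n) set \<Rightarrow> 'a set \<Rightarrow> ('a \<Rightarrow> complex^'n) \<Rightarrow> bool" where
  "extends_over_divisor f X A \<pi> \<Gamma> V D F \<longleftrightarrow>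
     openin (zariski_top X A) D \<and> D \<inter> \<Gamma> \<noteq> {} \<and> regular_map A D affine_atlas F \<and>
     (\<forall>p\<in>D. \<pi> p \<notin> hyperplane_at_infinity \<longrightarrow> F p = f (affine_part (\<pi> p))) \<and>
     F ` (\<Gamma> \<inter> D) \<subseteq> V \<and>
     (\<exists>V'. V' \<noteq> {} \<and> openin (subtopology (zariski_top UNIV affine_atlas) V) V' \<and>
        (\<forall>y\<in>V'. {p \<in> \<Gamma> \<inter> D. F p = y} \<noteq> {} \<and> finite {p \<in> \<Gamma> \<inter> D. F p = y}) \<and>
        (\<forall>p\<in>\<Gamma> \<inter> D. F p \<in> V' \<longrightarrow> etale_at X A \<Gamma> UNIV affine_atlas V F p))"


section \<open>The representation by u and gamma\<close>

abbreviation last_ix :: "(nat \<Rightarrow> 'n::finite) \<Rightarrow> 'n" where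
  "last_ix ix \<equiv> ix (CARD('n) - 1)"

text \<open>The tuple \<open>(\<gamma>\<^sub>1, \<dots>, \<gamma>\<^sub>n\<^sub>-\<^sub>1, u)\<close> is a vector in \<open>complex^'n\<close> with \<open>u\<close> as last coordinate.
  \<open>invert_last\<close> passes to the parameters \<open>(\<gamma>\<^sub>1, \<dots>, \<gamma>\<^sub>n\<^sub>-\<^sub>1, u\<^sup>-\<^sup>1)\<close> and back.\<close>

definition invert_last :: "(nat \<Rightarrow> 'n::finite) \<Rightarrow> complex^'n \<Rightarrow> complex^'n" where
  "invert_last ix q = (\<chi> k. if k = last_ix ix then inverse (q $ k) else q $ k)"

definition polydisc :: "real \<Rightarrow> (complex^'n) set" where
  "polydisc \<epsilon> = {w. \<forall>k. norm (w $ k) < \<epsilon>}"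

definition ug_domain :: "(nat \<Rightarrow> 'n::finite) \<Rightarrow> real \<Rightarrow> (complex^'n) set" where
  "ug_domain ix \<epsilon> = {q. q $ last_ix ix \<noteq> 0 \<and> invert_last ix q \<in> polydisc \<epsilon>}"

text \<open>\<open>\<tau> = (\<gamma>\<^sub>1, \<dots>, \<gamma>\<^sub>n\<^sub>-\<^sub>1, u\<^sup>-\<^sup>1)\<close> are local analytic parameters at \<open>e\<close>, on a neighbourhood \<open>N\<close> that
  they identify with a polydisc.  As \<open>\<Gamma>\<close> is the zero set of \<open>u\<^sup>-\<^sup>1\<close> on \<open>N\<close>, the \<open>\<gamma>\<^sub>j\<close> restrict to
  local analytic parameters of \<open>\<Gamma>\<close>, and \<open>u\<^sup>-\<^sup>m = 1 / x\<^sub>1 = X\<^sub>0 / X\<^sub>1\<close> has order \<open>m\<close> along \<open>\<Gamma>\<close>.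
  Genericity of \<open>e\<close> enters as follows: close to \<open>e\<close>, the morphism \<open>\<pi>\<close> is a local isomorphism
  outside \<open>\<Gamma>\<close>, i.e. no exceptional component other than \<open>\<Gamma>\<close> passes through \<open>e\<close>.
  The power series \<open>X\<^sub>i\<^sup>j(\<gamma>)\<close> is \<open>\<Xi> i j\<close> with coefficients \<open>c i j \<alpha>\<close>, the multi-indices \<open>\<alpha>\<close>
  involving only the \<open>\<gamma>\<close>-coordinates.\<close>

definition ug_representation ::
  "(nat \<Rightarrow> 'n::finite) \<Rightarrow> 'a set \<Rightarrow> ('a, 'k::finite) atlas \<Rightarrow> ('a \<Rightarrow> 'n line) \<Rightarrow> 'a set \<Rightarrow> 'a \<Rightarrow>
   nat \<Rightarrow> real \<Rightarrow> (complex^'n \<Rightarrow> complex^'n) \<Rightarrow> bool" where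
  "ug_representation ix X A \<pi> \<Gamma> e m \<epsilon> x \<longleftrightarrow> m \<ge> 1 \<and> \<epsilon> > 0 \<and> e \<in> \<Gamma> \<and>
     (\<exists>N \<tau> \<Xi> c.
        openin (classical_top X A) N \<and> e \<in> N \<and>
        N \<inter> exceptional_locus X A proj_space proj_atlas \<pi> \<subseteq> \<Gamma> \<and>
        biholomorphic A N affine_atlas (polydisc \<epsilon>) \<tau> \<and> \<tau> e = 0 \<and>
        N \<inter> \<Gamma> = {p \<in> N. \<tau> p $ last_ix ix = 0} \<and>
        (\<forall>p\<in>N. homog (\<pi> p) $ Some (ix 0) \<noteq> 0 \<and>
           (\<tau> p $ last_ix ix) ^ m = homog (\<pi> p) $ None / homog (\<pi> p) $ Some (ix 0)) \<and>
        (\<forall>p\<in>N. p \<notin> \<Gamma> \<longrightarrow> x (invert_last ix (\<tau> p)) = affine_part (\<pi> p)) \<and>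
        (\<forall>q\<in>ug_domain ix \<epsilon>. \<forall>j.
           (\<forall>i. ((\<lambda>\<alpha>. c i j \<alpha> * (\<Prod>k\<in>UNIV. q $ k ^ \<alpha> k)) has_sum \<Xi> i j q)
                  {\<alpha>. \<alpha> (last_ix ix) = 0}) \<and>
           (\<lambda>i. \<Xi> i j q * (q $ last_ix ix) powi (int m - int i)) sums (x q $ j)))"

text \<open>A trajectory of the system \<open>g\<^sub>i = r\<close>, \<open>g\<^sub>l = 0\<close> for \<open>l \<noteq> i\<close>, is a continuous branch of its
  solutions.  The parameter \<open>r\<close> ranges over any set \<open>R\<close> of complex numbers, which covers both
  complex domains and real intervals.\<close>

definition trajectory ::
  "(complex^'n \<Rightarrow> complex^'n) \<Rightarrow> (complex^'n) set \<Rightarrow> 'n::finite \<Rightarrow> complex set \<Rightarrow>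
   (complex \<Rightarrow> complex^'n) \<Rightarrow> bool" where
  "trajectory g S i R q \<longleftrightarrow> continuous_on R q \<and>
     (\<forall>r\<in>R. q r \<in> S \<and> (\<forall>l. g (q r) $ l = (if l = i then r else 0)))"


section \<open>The topologies, affine and projective space\<close>

lemma poly_fun_minus: "poly_fun P \<Longrightarrow> poly_fun Q \<Longrightarrow> poly_fun (\<lambda>z. P z - Q z)"
proof -
  assume "poly_fun P" "poly_fun Q"
  from poly_add[OF this(1) poly_mult[OF poly_const[of "-1"] this(2)]]
  show ?thesis by simp
qed

lemma zariski_closed_empty: "zariski_closed {}"
  unfolding zariski_closed_def
  by (rule exI[of _ "{\<lambda>_. 1}"]) (auto intro: poly_const)

lemma zariski_closed_UNIV: "zariski_closed UNIV"
  unfolding zariski_closed_def by (rule exI[of _ "{}"]) auto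

lemma zariski_closed_Un:
  assumes "zariski_closed S" "zariski_closed T" shows "zariski_closed (S \<union> T)"
proof -
  obtain I J where I: "\<forall>P\<in>I. poly_fun P" "S = {z. \<forall>P\<in>I. P z = 0}"
    and J: "\<forall>P\<in>J. poly_fun P" "T = {z. \<forall>P\<in>J. P z = 0}"
    using assms unfolding zariski_closed_def by blast
  have "S \<union> T = {z. \<forall>R\<in>{\<lambda>z. P z * Q z |P Q. P \<in> I \<and> Q \<in> J}. R z = 0}"
  proof (intro Set.set_eqI iffI)
    fix z assume "z \<in> S \<union> T"
    then show "z \<in> {z. \<forall>R\<in>{\<lambda>z. P z * Q z |P Q. P \<in> I \<and> Q \<in> J}. R z = 0}"
      using I(2) J(2) by auto
  next
    fix z assume "z \<in> {z. \<forall>R\<in>{\<lambda>z. P z * Q z |P Q. P \<in> I \<and> Q \<in> J}. R z = 0}"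
    then have R: "R z = 0" if "\<exists>P Q. R = (\<lambda>z. P z * Q z) \<and> P \<in> I \<and> Q \<in> J" for R
      using that by simp
    have "P z * Q z = 0" if "P \<in> I" "Q \<in> J" for P Q
      by (rule R[of "\<lambda>z. P z * Q z"]) (use that in metis)
    then show "z \<in> S \<union> T" unfolding I(2) J(2) by fastforce
  qed
  moreover have "\<forall>R\<in>{\<lambda>z. P z * Q z |P Q. P \<in> I \<and> Q \<in> J}. poly_fun R"
    using I(1) J(1) by (auto intro: poly_mult)
  ultimately show ?thesis unfolding zariski_closed_def by blast
qed

lemma zariski_closed_Inter:
  assumes "\<And>S. S \<in> \<S> \<Longrightarrow> zariski_closed S" shows "zariski_closed (\<Inter>\<S>)"
proof -
  define I where "I S = {P. poly_fun P \<and> (\<forall>z\<in>S. P z = 0)}" for S :: "(complex^'a) set"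
  have I: "S = {z. \<forall>P\<in>I S. P z = 0}" if S: "S \<in> \<S>" for S
  proof -
    obtain J where J: "\<forall>P\<in>J. poly_fun P" "S = {z. \<forall>P\<in>J. P z = 0}"
      using assms[OF S] unfolding zariski_closed_def by blast
    then have "J \<subseteq> I S" by (auto simp: I_def)
    then have "{z. \<forall>P\<in>I S. P z = 0} \<subseteq> S" unfolding J(2) by blast
    then show ?thesis by (auto simp: I_def)
  qed
  have "\<Inter>\<S> = {z. \<forall>P\<in>\<Union>(I ` \<S>). P z = 0}"
  proof (intro equalityI subsetI)
    fix z assume z: "z \<in> \<Inter>\<S>"
    have "P z = 0" if "S \<in> \<S>" "P \<in> I S" for S P
    proof -
      have "z \<in> {z. \<forall>P\<in>I S. P z = 0}" using z that(1) I[OF that(1)] by auto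
      then show ?thesis using that(2) by simp
    qed
    then show "z \<in> {z. \<forall>P\<in>\<Union>(I ` \<S>). P z = 0}" by simp
  next
    fix z assume z: "z \<in> {z. \<forall>P\<in>\<Union>(I ` \<S>). P z = 0}"
    have "z \<in> S" if "S \<in> \<S>" for S
      by (subst I[OF that]) (use z that in simp)
    then show "z \<in> \<Inter>\<S>" by blast
  qed
  moreover have "\<forall>P\<in>\<Union>(I ` \<S>). poly_fun P" by (simp add: I_def)
  ultimately show ?thesis unfolding zariski_closed_def by blast
qed

lemma openin_zariski_top:
  assumes "variety X A"
  shows "openin (zariski_top X A) W \<longleftrightarrow>
    W \<subseteq> X \<and> (\<forall>(U, \<phi>)\<in>A. zariski_closed (\<phi> ` (U - W)))"
proof -
  have A: "inj_on \<phi> U" "zariski_closed (\<phi> ` U)" if "(U, \<phi>) \<in> A" for U \<phi>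
    using assms that unfolding variety_def by auto
  have "istopology (\<lambda>W. W \<subseteq> X \<and> (\<forall>(U, \<phi>)\<in>A. zariski_closed (\<phi> ` (U - W))))"
    unfolding istopology_def
  proof (intro conjI allI impI)
    fix S T assume "S \<subseteq> X \<and> (\<forall>(U, \<phi>)\<in>A. zariski_closed (\<phi> ` (U - S)))"
      and "T \<subseteq> X \<and> (\<forall>(U, \<phi>)\<in>A. zariski_closed (\<phi> ` (U - T)))"
    then show "\<forall>(U, \<phi>)\<in>A. zariski_closed (\<phi> ` (U - S \<inter> T))"
      by (auto simp: Diff_Int image_Un intro!: zariski_closed_Un)
  next
    fix \<K> assume K: "\<forall>K\<in>\<K>. K \<subseteq> X \<and> (\<forall>(U, \<phi>)\<in>A. zariski_closed (\<phi> ` (U - K)))"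
    show "\<forall>(U, \<phi>)\<in>A. zariski_closed (\<phi> ` (U - \<Union>\<K>))"
    proof clarify
      fix U \<phi> assume U: "(U, \<phi>) \<in> A"
      have "\<phi> ` (U - \<Union>\<K>) = \<Inter>(insert (\<phi> ` U) ((\<lambda>K. \<phi> ` (U - K)) ` \<K>))"
      proof (intro equalityI subsetI)
        fix z assume z: "z \<in> \<Inter>(insert (\<phi> ` U) ((\<lambda>K. \<phi> ` (U - K)) ` \<K>))"
        then obtain x where x: "x \<in> U" "z = \<phi> x" by auto
        have "x \<notin> K" if "K \<in> \<K>" for K
        proof -
          have "z \<in> \<phi> ` (U - K)" using z that by blast
          then obtain y where "y \<in> U - K" "\<phi> y = \<phi> x" using x by auto
          then show ?thesis using A(1)[OF U] x by (auto dest: inj_onD)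
        qed
        then show "z \<in> \<phi> ` (U - \<Union>\<K>)" using x by blast
      qed auto
      moreover have "zariski_closed S" if "S \<in> insert (\<phi> ` U) ((\<lambda>K. \<phi> ` (U - K)) ` \<K>)" for S
        using that A(2)[OF U] K U by auto
      ultimately show "zariski_closed (\<phi> ` (U - \<Union>\<K>))"
        using zariski_closed_Inter by metis
    qed
  qed auto
  then show ?thesis unfolding zariski_top_def by (simp add: topology_inverse')
qed

lemma openin_classical_top:
  assumes "variety X A"
  shows "openin (classical_top X A) W \<longleftrightarrow>
    W \<subseteq> X \<and> (\<forall>(U, \<phi>)\<in>A. openin (top_of_set (\<phi> ` U)) (\<phi> ` (U \<inter> W)))"
proof -
  have A: "inj_on \<phi> U" if "(U, \<phi>) \<in> A" for U \<phi>
    using assms that unfolding variety_def by auto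
  have "istopology (\<lambda>W. W \<subseteq> X \<and> (\<forall>(U, \<phi>)\<in>A. openin (top_of_set (\<phi> ` U)) (\<phi> ` (U \<inter> W))))"
    unfolding istopology_def
  proof (intro conjI allI impI)
    fix S T assume ST: "S \<subseteq> X \<and> (\<forall>(U, \<phi>)\<in>A. openin (top_of_set (\<phi> ` U)) (\<phi> ` (U \<inter> S)))"
      "T \<subseteq> X \<and> (\<forall>(U, \<phi>)\<in>A. openin (top_of_set (\<phi> ` U)) (\<phi> ` (U \<inter> T)))"
    show "\<forall>(U, \<phi>)\<in>A. openin (top_of_set (\<phi> ` U)) (\<phi> ` (U \<inter> (S \<inter> T)))"
    proof clarify
      fix U \<phi> assume U: "(U, \<phi>) \<in> A"
      have "\<phi> ` (U \<inter> (S \<inter> T)) = \<phi> ` (U \<inter> S) \<inter> \<phi> ` (U \<inter> T)"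
        using A[OF U] by (auto simp: inj_on_def)
      then show "openin (top_of_set (\<phi> ` U)) (\<phi> ` (U \<inter> (S \<inter> T)))"
        using ST U by (auto intro!: openin_Int)
    qed
  next
    fix \<K> assume K: "\<forall>K\<in>\<K>. K \<subseteq> X \<and> (\<forall>(U, \<phi>)\<in>A. openin (top_of_set (\<phi> ` U)) (\<phi> ` (U \<inter> K)))"
    show "\<forall>(U, \<phi>)\<in>A. openin (top_of_set (\<phi> ` U)) (\<phi> ` (U \<inter> \<Union>\<K>))"
    proof clarify
      fix U \<phi> assume U: "(U, \<phi>) \<in> A"
      have "\<phi> ` (U \<inter> \<Union>\<K>) = (\<Union>K\<in>\<K>. \<phi> ` (U \<inter> K))" by auto
      moreover have "openin (top_of_set (\<phi> ` U)) (\<phi> ` (U \<inter> K))" if "K \<in> \<K>" for K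
        using K U that by auto
      ultimately show "openin (top_of_set (\<phi> ` U)) (\<phi> ` (U \<inter> \<Union>\<K>))"
        by (auto intro!: openin_Union)
    qed
  qed auto
  then show ?thesis unfolding classical_top_def by (simp add: topology_inverse')
qed

lemma variety_affine: "variety UNIV affine_atlas"
proof -
  have "regular_map affine_atlas UNIV affine_atlas (\<lambda>x::complex^'n. x)"
    unfolding regular_map_def affine_atlas_def
    apply auto
    apply (rule exI[of _ "\<lambda>k z. z $ k"])
    apply (auto intro!: poly_coord exI[of _ "\<lambda>_. 1"] poly_const)
    done
  moreover have "zariski_closed (range (\<lambda>x::complex^'n. (\<chi> s. case s of Inl k \<Rightarrow> x $ k | Inr k \<Rightarrow> x $ k) :: complex^('n + 'n)))"
  proof -
    have "range (\<lambda>x::complex^'n. (\<chi> s. case s of Inl k \<Rightarrow> x $ k | Inr k \<Rightarrow> x $ k) :: complex^('n + 'n))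
      = {z. \<forall>P\<in>range (\<lambda>k z. z $ Inl k - z $ Inr k). P z = 0}"
      apply (auto)
      subgoal for z
        by (rule range_eqI[of _ _ "\<chi> k. z $ Inl k"]) (simp add: Finite_Cartesian_Product.vec_eq_iff split: sum.splits)
      done
    then show ?thesis unfolding zariski_closed_def
      by (intro exI[of _ "range (\<lambda>k z. z $ Inl k - z $ Inr k)"]) (auto intro: poly_fun_minus poly_coord)
  qed
  ultimately show ?thesis unfolding variety_def
    by (auto simp: affine_atlas_def zariski_closed_UNIV)
qed

lemma classical_top_affine: "classical_top UNIV affine_atlas = (euclidean :: (complex^'n) topology)"
  by (simp add: topology_eq openin_classical_top[OF variety_affine])
     (simp add: affine_atlas_def)

text \<open>For the index \<open>p\<close> of a standard chart of projective space, \<open>chart_ix p j\<close> is the homogeneous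
  coordinate behind its \<open>j\<close>-th coordinate, and \<open>dehom p\<close> inverts the chart.\<close>

definition chart_ix :: "'n option \<Rightarrow> 'n \<Rightarrow> 'n option" where
  "chart_ix p j = (if p = Some j then None else Some j)"

definition dehom :: "'n option \<Rightarrow> complex^'n \<Rightarrow> complex^('n option)" where
  "dehom p z = (\<chi> k. if k = p then 1 else case k of None \<Rightarrow> z $ the p | Some j \<Rightarrow> z $ j)"

lemma proj_atlas_alt:
  "(proj_atlas :: ('a::finite line, 'a) atlas) = range (\<lambda>p. ({l \<in> proj_space. homog l $ p \<noteq> 0},
     \<lambda>l. \<chi> j. homog l $ chart_ix p j / homog l $ p))"
proof -
  have "(affine_part :: 'a line \<Rightarrow> _) = (\<lambda>l. \<chi> j. homog l $ chart_ix None j / homog l $ None)"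
    by (auto simp: affine_part_def chart_ix_def fun_eq_iff)
  moreover have "(if j = i then None else Some j) = chart_ix (Some i) j" for i j :: 'a
    by (auto simp: chart_ix_def)
  ultimately show ?thesis
    unfolding proj_atlas_def by (simp add: UNIV_option_conv image_image)
qed

lemma homog_span:
  fixes v :: "complex^('n::finite option)"
  assumes "v \<noteq> 0"
  obtains c where "c \<noteq> 0" "homog (vec.span {v}) = c *s v"
proof -
  have "\<exists>w. w \<in> vec.span {v} \<and> w \<noteq> 0" using assms by (intro exI[of _ v]) (simp add: vec.span_base)
  then have "homog (vec.span {v}) \<in> vec.span {v} \<and> homog (vec.span {v}) \<noteq> 0"
    unfolding homog_def by (rule someI_ex)
  then show ?thesis using that by (auto simp: vec.span_singleton)
qed

lemma span_scale:
  fixes v :: "complex^'m::finite"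
  assumes "c \<noteq> 0"
  shows "vec.span {c *s v} = vec.span {v}"
proof (intro equalityI vec.span_minimal)
  show "{c *s v} \<subseteq> vec.span {v}" by (simp add: vec.span_scale vec.span_base)
  have "v = inverse c *s (c *s v)" using assms by (simp add: vector_smult_assoc)
  then have "v \<in> vec.span {c *s v}" using vec.span_scale[OF vec.span_base[of "c *s v"]] by (metis insertI1)
  then show "{v} \<subseteq> vec.span {c *s v}" by simp
qed (simp_all add: vec.subspace_span)

lemma homog_proj:
  assumes "l \<in> proj_space"
  shows "l = vec.span {homog l}"
proof -
  obtain v where v: "v \<noteq> 0" "l = vec.span {v}" using assms unfolding proj_space_def by auto
  obtain c where c: "c \<noteq> 0" "homog l = c *s v" using homog_span[OF v(1)] v(2) by metis
  show ?thesis using span_scale[OF c(1), of v] v(2) c(2) by simp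
qed

lemma homog_dehom:
  assumes "homog l $ p \<noteq> 0"
  shows "homog l = (homog l $ p) *s dehom p (\<chi> j. homog l $ chart_ix p j / homog l $ p)"
proof -
  have "homog l $ k = homog l $ p * dehom p (\<chi> j. homog l $ chart_ix p j / homog l $ p) $ k" for k
    using assms by (cases k; cases p) (auto simp: dehom_def chart_ix_def)
  then show ?thesis unfolding Finite_Cartesian_Product.vec_eq_iff vector_smult_component by (rule allI)
qed

lemma dehom_chart:
  fixes z :: "complex^'n::finite"
  shows "vec.span {dehom p z} \<in> proj_space"
    "homog (vec.span {dehom p z}) $ p \<noteq> 0"
    "(\<chi> j. homog (vec.span {dehom p z}) $ chart_ix p j / homog (vec.span {dehom p z}) $ p) = z"
    "homog (vec.span {dehom p z}) $ k / homog (vec.span {dehom p z}) $ k' = dehom p z $ k / dehom p z $ k'"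
    "homog (vec.span {dehom p z}) $ k = 0 \<longleftrightarrow> dehom p z $ k = 0"
proof -
  have p: "dehom p z $ p = 1" by (simp add: dehom_def)
  then have "dehom p z \<noteq> 0" by auto
  then show "vec.span {dehom p z} \<in> proj_space" unfolding proj_space_def by blast
  obtain c where c: "c \<noteq> 0" "homog (vec.span {dehom p z}) = c *s dehom p z"
    using homog_span \<open>dehom p z \<noteq> 0\<close> by metis
  show "homog (vec.span {dehom p z}) $ p \<noteq> 0" using c p by simp
  show "(\<chi> j. homog (vec.span {dehom p z}) $ chart_ix p j / homog (vec.span {dehom p z}) $ p) = z"
  proof -
    have "dehom p z $ chart_ix p j = z $ j" for j
      by (cases p) (auto simp: dehom_def chart_ix_def)
    then show ?thesis using c p by (simp add: Finite_Cartesian_Product.vec_eq_iff)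
  qed
  show "homog (vec.span {dehom p z}) $ k / homog (vec.span {dehom p z}) $ k' = dehom p z $ k / dehom p z $ k'"
    "homog (vec.span {dehom p z}) $ k = 0 \<longleftrightarrow> dehom p z $ k = 0"
    using c by auto
qed

lemma poly_dehom: "poly_fun (\<lambda>z. dehom p z $ k)"
  by (cases "k = p"; cases k) (auto simp: dehom_def intro: poly_const poly_coord)

lemma poly_fun_compose:
  assumes "poly_fun P" "\<And>k. poly_fun (\<lambda>z. g z $ k)"
  shows "poly_fun (\<lambda>z. P (g z))"
  using assms(1) by induction (auto intro: poly_const poly_add poly_mult assms(2))

lemma variety_proj: "variety (proj_space :: 'n::finite line set) proj_atlas"
proof -
  define U where "U p = {l \<in> proj_space :: 'n line set. homog l $ p \<noteq> 0}" for p
  define \<phi> where "\<phi> p l = (\<chi> j. homog l $ chart_ix p j / homog l $ p)" for p and l :: "'n line"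
  have at: "proj_atlas = range (\<lambda>p. (U p, \<phi> p))"
    unfolding proj_atlas_alt U_def \<phi>_def by simp
  have inv: "vec.span {dehom p (\<phi> p l)} = l" if "l \<in> U p" for p l
  proof -
    have l: "l \<in> proj_space" "homog l $ p \<noteq> 0" using that by (auto simp: U_def)
    have h: "homog l = (homog l $ p) *s dehom p (\<phi> p l)"
      unfolding \<phi>_def by (rule homog_dehom[OF l(2)])
    have "vec.span {dehom p (\<phi> p l)} = vec.span {homog l}"
      using span_scale[OF l(2), of "dehom p (\<phi> p l)"] h by simp
    then show ?thesis using homog_proj[OF l(1)] by simp
  qed
  have inv': "vec.span {dehom p z} \<in> U p" "\<phi> p (vec.span {dehom p z}) = z" for p z
    using dehom_chart[of p z] by (auto simp: U_def \<phi>_def)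
  have inj: "inj_on (\<phi> p) (U p)" for p by (rule inj_on_inverseI) (rule inv)
  have surj: "\<phi> p ` U p = UNIV" for p 
  proof -
    have "z \<in> \<phi> p ` U p" for z
      by (rule image_eqI[where x = "vec.span {dehom p z}"]) (simp_all only: inv')
    then show ?thesis by blast
  qed
  have mem: "l \<in> U p' \<longleftrightarrow> dehom p (\<phi> p l) $ p' \<noteq> 0" if "l \<in> U p" for l p p'
    using dehom_chart(1,5)[of p "\<phi> p l"] inv[OF that] by (auto simp: U_def)
  have tr: "\<phi> p' l $ j = dehom p (\<phi> p l) $ chart_ix p' j / dehom p (\<phi> p l) $ p'"
    if "l \<in> U p" for l p p' j
  proof -
    have "\<phi> p' l $ j = homog l $ chart_ix p' j / homog l $ p'" by (simp add: \<phi>_def)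
    also have "\<dots> = dehom p (\<phi> p l) $ chart_ix p' j / dehom p (\<phi> p l) $ p'"
      using dehom_chart(4)[of p "\<phi> p l"] unfolding inv[OF that] .
    finally show ?thesis .
  qed
  have cover: "\<exists>p. l \<in> U p" if l: "l \<in> proj_space" for l
  proof (rule ccontr)
    assume "\<nexists>p. l \<in> U p"
    then have "homog l = 0" using that by (auto simp: U_def Finite_Cartesian_Product.vec_eq_iff)
    moreover obtain v where "v \<noteq> 0" "l = vec.span {v}" using l unfolding proj_space_def by auto
    ultimately show False using homog_span[of v] by (auto simp: Finite_Cartesian_Product.vec_eq_iff)
  qed
  have un: "(proj_space :: 'n line set) = (\<Union>(U, \<phi>)\<in>proj_atlas. U)"
    unfolding at using cover by (auto simp: U_def)
  have reg: "regular_map proj_atlas proj_space proj_atlas (\<lambda>x::'n line. x)"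
    unfolding regular_map_def
  proof (intro conjI ballI)
    fix l :: "'n line" assume "l \<in> proj_space"
    then show "\<exists>(V, \<psi>)\<in>proj_atlas. l \<in> V" using cover unfolding at by fastforce
  next
    fix l and c :: "'n line set \<times> ('n line \<Rightarrow> complex^'n)"
    assume l: "l \<in> (proj_space :: 'n line set)" and "c \<in> proj_atlas"
    show "case c of (U, \<phi>) \<Rightarrow> \<forall>(V, \<psi>)\<in>proj_atlas. l \<in> U \<and> l \<in> V \<longrightarrow>
        (\<exists>P Q. (\<forall>k. poly_fun (P k)) \<and> poly_fun Q \<and> Q (\<phi> l) \<noteq> 0 \<and>
           (\<forall>x\<in>proj_space \<inter> U. Q (\<phi> x) \<noteq> 0 \<longrightarrow> x \<in> V \<and> \<psi> x = (\<chi> k. P k (\<phi> x) / Q (\<phi> x))))"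
    proof -
      from \<open>c \<in> proj_atlas\<close> obtain p where c: "c = (U p, \<phi> p)" unfolding at by auto
      show ?thesis unfolding c prod.case
      proof (clarsimp simp: at)
        fix p' assume "l \<in> U p" "l \<in> U p'"
        then show "\<exists>P. (\<forall>k. poly_fun (P k)) \<and> (\<exists>Q. poly_fun Q \<and> Q (\<phi> p l) \<noteq> 0 \<and>
           (\<forall>x\<in>proj_space \<inter> U p. Q (\<phi> p x) \<noteq> 0 \<longrightarrow>
              x \<in> U p' \<and> \<phi> p' x = (\<chi> k. P k (\<phi> p x) / Q (\<phi> p x))))"
          by (intro exI[of _ "\<lambda>k z. dehom p z $ chart_ix p' k"] exI[of _ "\<lambda>z. dehom p z $ p'"]
                conjI allI poly_dehom)
             (use mem[of l p p'] in \<open>auto simp: mem[of _ p p'] tr[of _ p p'] Finite_Cartesian_Product.vec_eq_iff\<close>)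
      qed
    qed
  qed
  have sep: "zariski_closed ((\<lambda>x. (\<chi> s. case s of Inl k \<Rightarrow> \<phi> p x $ k | Inr k \<Rightarrow> \<phi> p' x $ k)
      :: complex^('n + 'n)) ` (U p \<inter> U p'))" (is "zariski_closed (?h ` _)") for p p'
  proof -
    define a where "a w = (\<chi> k. w $ Inl k)" for w :: "complex^('n + 'n)"
    define b where "b w = (\<chi> k. w $ Inr k)" for w :: "complex^('n + 'n)"
    define Q where "Q k w = dehom p (a w) $ k - dehom p (a w) $ p' * dehom p' (b w) $ k" for k w
    have Q: "poly_fun (Q k)" for k
      unfolding Q_def
      by (intro poly_fun_minus poly_mult poly_fun_compose[OF poly_dehom])
         (auto simp: a_def b_def intro: poly_coord)
    have "?h ` (U p \<inter> U p') = {w. \<forall>k. Q k w = 0}"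
    proof (intro Set.set_eqI iffI)
      fix w assume "w \<in> ?h ` (U p \<inter> U p')"
      then obtain l where l: "l \<in> U p" "l \<in> U p'" and w: "w = ?h l" by auto
      have ab: "a w = \<phi> p l" "b w = \<phi> p' l" by (auto simp: w a_def b_def)
      have h: "homog l = (homog l $ p) *s dehom p (a w)" "homog l = (homog l $ p') *s dehom p' (b w)"
        unfolding ab using l homog_dehom by (auto simp: U_def \<phi>_def)
      have nz: "homog l $ p \<noteq> 0" using l by (auto simp: U_def)
      have 1: "homog l $ k = homog l $ p * dehom p (a w) $ k"
        "homog l $ k = homog l $ p' * dehom p' (b w) $ k" for k
        using arg_cong[OF h(1), of "\<lambda>v. v $ k"] arg_cong[OF h(2), of "\<lambda>v. v $ k"] by auto
      have "Q k w = 0" for k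
      proof -
        have "homog l $ p * dehom p (a w) $ k = homog l $ p * (dehom p (a w) $ p' * dehom p' (b w) $ k)"
          using 1(1)[of k] 1(2)[of k] 1(1)[of p'] by (metis mult.assoc)
        then show ?thesis using nz by (simp add: Q_def)
      qed
      then show "w \<in> {w. \<forall>k. Q k w = 0}" by blast
    next
      fix w assume "w \<in> {w. \<forall>k. Q k w = 0}"
      then have "Q k w = 0" for k by blast
      then have q: "dehom p (a w) $ k = dehom p (a w) $ p' * dehom p' (b w) $ k" for k
        using Q_def[of k w] by simp
      have nz: "dehom p (a w) $ p' \<noteq> 0" using q[of p] by (auto simp: dehom_def)
      define l where "l = vec.span {dehom p (a w)}"
      have l: "l \<in> U p" "\<phi> p l = a w" using inv'[of p "a w"] by (auto simp: l_def)
      then have l': "l \<in> U p'" using mem[of l p p'] nz by simp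
      have "\<phi> p' l $ j = b w $ j" for j
      proof -
        have "\<phi> p' l $ j = dehom p (a w) $ chart_ix p' j / dehom p (a w) $ p'"
          using tr[OF l(1)] l(2) by simp
        also have "\<dots> = dehom p' (b w) $ chart_ix p' j" using q[of "chart_ix p' j"] nz by simp
        also have "\<dots> = b w $ j" by (auto simp: dehom_def chart_ix_def)
        finally show ?thesis .
      qed
      then have "w = ?h l"
        using l(2) by (auto simp: Finite_Cartesian_Product.vec_eq_iff a_def b_def split: sum.splits)
      then show "w \<in> ?h ` (U p \<inter> U p')" using l(1) l' by blast
    qed
    then show ?thesis unfolding zariski_closed_def
      using Q by (intro exI[of _ "range Q"]) auto
  qed
  show ?thesis
    unfolding variety_def
    using un reg sep inj surj by (auto simp: at zariski_closed_UNIV)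
qed

end

(* The coordinate map x is locally biholomorphic in (gamma, u): away from Gamma the modification pi
   is locally biregular, and the local parameters and 1/u are local coordinates.  Since f has
   Jacobian determinant 1, the chain rule gives L = |J(x)|, which is nonzero.  Differentiating
   f_l(q(r)) = delta_{li} r along a continuous solution q yields J(fhat) q' = e_i, and Cramer's rule
   expresses q' by the cofactors of the i-th row; the i-th equation is the asserted identity. *)
theory Submission
  imports Defs
begin

section \<open>Complex differentiable maps and their Jacobian matrices\<close>

text \<open>For a real Frechet derivative, homogeneity over the complex numbers amounts to the
  Cauchy-Riemann equations, so this is complex differentiability at a single point.\<close>

definition scalar_cderiv ::
  "(complex^'a::finite \<Rightarrow> complex) \<Rightarrow> (complex^'a \<Rightarrow> complex) \<Rightarrow> complex^'a \<Rightarrow> bool" where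
  "scalar_cderiv g D z \<longleftrightarrow> (g has_derivative D) (at z) \<and> (\<forall>c v. D (c *s v) = c * D v)"

definition cderiv ::
  "(complex^'a::finite \<Rightarrow> complex^'b::finite) \<Rightarrow> (complex^'a \<Rightarrow> complex^'b) \<Rightarrow> complex^'a \<Rightarrow> bool" where
  "cderiv g D z \<longleftrightarrow> (g has_derivative D) (at z) \<and> (\<forall>c v. D (c *s v) = c *s D v)"

abbreviation cdiff where "cdiff g z \<equiv> \<exists>D. cderiv g D z"
abbreviation scalar_cdiff where "scalar_cdiff g z \<equiv> \<exists>D. scalar_cderiv g D z"

text \<open>The remainder quotient tends to zero because each of its finitely many coordinates does,
  and a linear map on a Euclidean space is bounded.\<close>

lemma has_derivative_vec_lambda:
  fixes g :: "'b::euclidean_space \<Rightarrow> complex^'a::finite"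
  assumes "\<And>k. ((\<lambda>z. g z $ k) has_derivative D k) F"
  shows "(g has_derivative (\<lambda>v. \<chi> k. D k v)) F"
proof -
  have D: "linear (D k)" for k using assms by (rule has_derivative_linear)
  have "linear (\<lambda>v. \<chi> k. D k v)"
    by (rule linearI) (simp_all add: Finite_Cartesian_Product.vec_eq_iff linear_add[OF D] linear_scale[OF D])
  moreover have "((\<lambda>y. (1 / norm (y - Lim F (\<lambda>x. x))) *\<^sub>R
      ((g y - g (Lim F (\<lambda>x. x))) - (\<chi> k. D k (y - Lim F (\<lambda>x. x))))) \<longlongrightarrow> 0) F"
  proof (rule vec_tendstoI)
    fix k
    show "((\<lambda>y. ((1 / norm (y - Lim F (\<lambda>x. x))) *\<^sub>R
      ((g y - g (Lim F (\<lambda>x. x))) - (\<chi> k. D k (y - Lim F (\<lambda>x. x))))) $ k) \<longlongrightarrow> 0 $ k) F"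
      using assms[of k] by (simp add: has_derivative_def divide_inverse)
  qed
  ultimately show ?thesis
    by (simp add: has_derivative_def linear_conv_bounded_linear divide_inverse)
qed

lemma cdiff_componentwise:
  assumes "\<And>k. scalar_cdiff (\<lambda>z. g z $ k) z"
  shows "cdiff g z"
proof -
  obtain D where "\<And>k. scalar_cderiv (\<lambda>z. g z $ k) (D k) z" using assms by metis
  then have "cderiv g (\<lambda>v. \<chi> k. D k v) z"
    by (auto simp: cderiv_def scalar_cderiv_def Finite_Cartesian_Product.vec_eq_iff
        intro!: has_derivative_vec_lambda)
  then show ?thesis by blast
qed

lemma scalar_cderiv_component: "cderiv g D z \<Longrightarrow> scalar_cderiv (\<lambda>w. g w $ k) (\<lambda>v. D v $ k) z"
  by (auto simp: cderiv_def scalar_cderiv_def intro: bounded_linear.has_derivative[OF bounded_linear_vec_nth])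

section \<open>Closure properties of complex differentiability\<close>

lemma scalar_cdiff_const: "scalar_cdiff (\<lambda>_. c) z"
  by (rule exI[of _ "\<lambda>_. 0"]) (simp add: scalar_cderiv_def)

lemma scalar_cdiff_coord: "scalar_cdiff (\<lambda>w. w $ k) z"
  by (rule exI[of _ "\<lambda>v. v $ k"])
     (simp add: scalar_cderiv_def bounded_linear_imp_has_derivative bounded_linear_vec_nth)

lemma scalar_cdiff_add:
  assumes "scalar_cdiff P z" "scalar_cdiff Q z"
  shows "scalar_cdiff (\<lambda>w. P w + Q w) z"
proof -
  obtain P' Q' where "scalar_cderiv P P' z" "scalar_cderiv Q Q' z" using assms by blast
  then have "scalar_cderiv (\<lambda>w. P w + Q w) (\<lambda>v. P' v + Q' v) z"
    by (auto simp: scalar_cderiv_def algebra_simps intro: has_derivative_add)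
  then show ?thesis by blast
qed

lemma scalar_cdiff_mult:
  assumes "scalar_cdiff P z" "scalar_cdiff Q z"
  shows "scalar_cdiff (\<lambda>w. P w * Q w) z"
proof -
  obtain P' Q' where "scalar_cderiv P P' z" "scalar_cderiv Q Q' z" using assms by blast
  then have "scalar_cderiv (\<lambda>w. P w * Q w) (\<lambda>v. P z * Q' v + P' v * Q z) z"
    by (auto simp: scalar_cderiv_def algebra_simps intro: has_derivative_mult)
  then show ?thesis by blast
qed

lemma scalar_cdiff_inverse:
  assumes "scalar_cdiff P z" "P z \<noteq> 0"
  shows "scalar_cdiff (\<lambda>w. inverse (P w)) z"
proof -
  obtain P' where "scalar_cderiv P P' z" using assms by blast
  then have "scalar_cderiv (\<lambda>w. inverse (P w)) (\<lambda>v. - (inverse (P z) * P' v * inverse (P z))) z"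
    using assms(2) Deriv.has_derivative_inverse[of P z P' UNIV]
    by (simp add: scalar_cderiv_def mult.left_commute)
  then show ?thesis by blast
qed

lemma scalar_cdiff_poly: "poly_fun P \<Longrightarrow> scalar_cdiff P z"
  by (induction rule: poly_fun.induct)
     (intro scalar_cdiff_const scalar_cdiff_coord scalar_cdiff_add scalar_cdiff_mult; assumption)+

lemma cdiff_poly: "(\<And>k. poly_fun (\<lambda>z. g z $ k)) \<Longrightarrow> cdiff g z"
  by (rule cdiff_componentwise) (rule scalar_cdiff_poly)

lemma cdiff_poly_quotient:
  assumes "\<And>k. poly_fun (P k)" "poly_fun Q" "Q z \<noteq> 0"
  shows "cdiff (\<lambda>w. \<chi> k. P k w / Q w) z"
  using assms
  by (intro cdiff_componentwise)
     (simp add: divide_inverse scalar_cdiff_mult scalar_cdiff_inverse scalar_cdiff_poly)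

lemma cderiv_compose:
  assumes "cderiv h E z" "cderiv g D (h z)"
  shows "cderiv (\<lambda>w. g (h w)) (\<lambda>v. D (E v)) z"
  using assms by (auto simp: cderiv_def intro: has_derivative_compose)

lemma cdiff_compose: "cdiff h z \<Longrightarrow> cdiff g (h z) \<Longrightarrow> cdiff (\<lambda>w. g (h w)) z"
  using cderiv_compose by blast

text \<open>Agreement on \<open>nhds z\<close>, and not only on the punctured filter
  \<open>at z\<close>, includes the value at \<open>z\<close>, on which the derivative
  depends.\<close>

lemma cderiv_transform:
  assumes "cderiv g D z" "\<forall>\<^sub>F w in nhds z. h w = g w"
  shows "cderiv h D z"
proof -
  have "\<forall>\<^sub>F w in at z. g w = h w"
    using assms(2) by (auto simp: eventually_at_filter elim: eventually_mono)
  moreover have "g z = h z" using eventually_nhds_x_imp_x[OF assms(2)] by simp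
  ultimately show ?thesis
    using assms(1) by (auto simp: cderiv_def intro: has_derivative_transform_eventually)
qed

lemma cdiff_tendsto: "cdiff g z \<Longrightarrow> (g \<longlongrightarrow> g z) (nhds z)"
  by (auto simp: cderiv_def isCont_def simp flip: tendsto_at_iff_tendsto_nhds
      dest!: has_derivative_continuous)

lemma holo_on_cdiff: "holo_on S G \<Longrightarrow> z \<in> S \<Longrightarrow> cdiff G z"
  by (auto simp: holo_on_def cderiv_def)

section \<open>Partial derivatives and Jacobian matrices\<close>

lemma partial_scalar_cderiv:
  assumes "scalar_cderiv g D z"
  shows "partial g k z = D (axis k 1)"
proof -
  have D: "(g has_derivative D) (at z)" "\<And>c v. D (c *s v) = c * D v"
    using assms by (auto simp: scalar_cderiv_def)
  have "((\<lambda>s. (\<chi> l. if l = k then s else z $ l)) has_derivative (\<lambda>t. \<chi> l. if l = k then t else 0))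
      (at (z $ k))"
  proof (rule has_derivative_vec_lambda)
    fix l
    show "((\<lambda>s. (\<chi> l. if l = k then s else z $ l) $ l) has_derivative (\<lambda>t. if l = k then t else 0)) (at (z $ k))"
      by (cases "l = k") auto
  qed
  moreover have "(\<lambda>t. \<chi> l. if l = k then t else 0) = (\<lambda>t::complex. t *s axis k 1)"
    by (auto simp: axis_def Finite_Cartesian_Product.vec_eq_iff)
  moreover have "(\<chi> l. if l = k then z $ k else z $ l) = z"
    by (simp add: Finite_Cartesian_Product.vec_eq_iff)
  ultimately have "((\<lambda>s. g (\<chi> l. if l = k then s else z $ l)) has_derivative (\<lambda>t. D (t *s axis k 1)))
      (at (z $ k))"
    using D(1) has_derivative_compose[of "\<lambda>s. (\<chi> l. if l = k then s else z $ l)" _ "z $ k" UNIV g D]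
    by simp
  \<comment> \<open>Complex homogeneity turns the real derivative along the coordinate line into
    multiplication by the number \<open>D (axis k 1)\<close>, hence into a complex
    derivative.\<close>
  then have "((\<lambda>s. g (\<chi> l. if l = k then s else z $ l)) has_field_derivative D (axis k 1)) (at (z $ k))"
    by (simp add: D(2) has_field_derivative_def mult.commute[of _ "D (axis k 1)"])
  then show ?thesis unfolding partial_def by (rule DERIV_imp_deriv)
qed

text \<open>Expand \<open>v\<close> in the standard basis: sums pass through \<open>D\<close> by
  real linearity, the complex coefficients by homogeneity.\<close>

lemma cderiv_apply:
  assumes "cderiv g D z"
  shows "D v $ j = (\<Sum>k\<in>UNIV. partial (\<lambda>w. g w $ j) k z * v $ k)"
proof -
  have D: "linear D" "\<And>c v. D (c *s v) = c *s D v"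
    using assms by (auto simp: cderiv_def intro: has_derivative_linear)
  have "D v = D (\<Sum>k\<in>UNIV. v $ k *s axis k 1)" by (simp add: basis_expansion)
  also have "\<dots> = (\<Sum>k\<in>UNIV. v $ k *s D (axis k 1))"
    by (simp add: linear_sum[OF D(1)] D(2))
  finally show ?thesis
    by (simp add: partial_scalar_cderiv[OF scalar_cderiv_component[OF assms]] mult.commute)
qed

lemma jacobian_carrier: "jacobian ix (g :: complex^'n::finite \<Rightarrow> _) z \<in> carrier_mat CARD('n) CARD('n)"
  by (simp add: jacobian_def)

text \<open>Reindexing the sum over the coordinate type by the bijection \<open>ix\<close> connects
  the derivative as a linear map with a matrix indexed by natural numbers.\<close>

lemma cderiv_jacobian:
  fixes g :: "complex^'n::finite \<Rightarrow> complex^'n"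
  assumes "bij_betw ix {..<CARD('n)} UNIV" "cderiv g D z" "i < CARD('n)"
  shows "D v $ ix i = (\<Sum>j<CARD('n). jacobian ix g z $$ (i, j) * v $ ix j)"
proof -
  have "D v $ ix i = (\<Sum>j<CARD('n). partial (\<lambda>w. g w $ ix i) (ix j) z * v $ ix j)"
    unfolding cderiv_apply[OF assms(2)]
    by (rule sum.reindex_bij_betw[OF assms(1), symmetric])
  then show ?thesis using assms(3) by (simp add: jacobian_def)
qed

lemma jacobian_compose:
  fixes g h :: "complex^'n::finite \<Rightarrow> complex^'n"
  assumes ix: "bij_betw ix {..<CARD('n)} UNIV" and h: "cdiff h z" and g: "cdiff g (h z)"
  shows "jacobian ix (\<lambda>w. g (h w)) z = jacobian ix g (h z) * jacobian ix h z"
proof -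
  obtain D E where D: "cderiv g D (h z)" and E: "cderiv h E z" using g h by blast
  show ?thesis
  proof (rule eq_matI)
    fix i j
    assume "i < dim_row (jacobian ix g (h z) * jacobian ix h z)"
      "j < dim_col (jacobian ix g (h z) * jacobian ix h z)"
    then have ij: "i < CARD('n)" "j < CARD('n)" by (auto simp: jacobian_def)
    \<comment> \<open>The \<open>j\<close>-th column of the inner Jacobian is the image of the
      \<open>j\<close>-th basis vector.\<close>
    have E': "E (axis (ix j) 1) $ ix k = jacobian ix h z $$ (k, j)" if "k < CARD('n)" for k
      using ij that by (simp add: jacobian_def partial_scalar_cderiv[OF scalar_cderiv_component[OF E]])
    have "jacobian ix (\<lambda>w. g (h w)) z $$ (i, j) = D (E (axis (ix j) 1)) $ ix i"
      using ij by (simp add: jacobian_def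
          partial_scalar_cderiv[OF scalar_cderiv_component[OF cderiv_compose[OF E D]]])
    also have "\<dots> = (\<Sum>k<CARD('n). jacobian ix g (h z) $$ (i, k) * jacobian ix h z $$ (k, j))"
      unfolding cderiv_jacobian[OF ix D ij(1)] by (rule sum.cong) (simp_all add: E')
    also have "\<dots> = (jacobian ix g (h z) * jacobian ix h z) $$ (i, j)"
      using ij by (simp add: times_mat_def Matrix.scalar_prod_def jacobian_def atLeast0LessThan)
    finally show "jacobian ix (\<lambda>w. g (h w)) z $$ (i, j) = (jacobian ix g (h z) * jacobian ix h z) $$ (i, j)" .
  qed (simp_all add: jacobian_def)
qed

lemma det_jacobian_compose:
  fixes g h :: "complex^'n::finite \<Rightarrow> complex^'n"
  assumes "bij_betw ix {..<CARD('n)} UNIV" "cdiff h z" "cdiff g (h z)"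
  shows "det (jacobian ix (\<lambda>w. g (h w)) z) = det (jacobian ix g (h z)) * det (jacobian ix h z)"
  unfolding jacobian_compose[OF assms] by (rule det_mult[OF jacobian_carrier jacobian_carrier])

lemma jacobian_local_id:
  fixes g :: "complex^'n::finite \<Rightarrow> complex^'n"
  assumes ix: "bij_betw ix {..<CARD('n)} UNIV" and g: "\<forall>\<^sub>F w in nhds z. g w = w"
  shows "jacobian ix g z = 1\<^sub>m CARD('n)"
proof -
  have "cderiv (\<lambda>w. w) (\<lambda>v. v) z" by (simp add: cderiv_def)
  from cderiv_transform[OF this g] have "cderiv g (\<lambda>v. v) z" .
  moreover have "ix i = ix j \<longleftrightarrow> i = j" if "i < CARD('n)" "j < CARD('n)" for i j
    using ix that by (auto simp: bij_betw_def inj_on_def)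
  ultimately show ?thesis
    by (intro eq_matI)
       (auto simp: jacobian_def axis_def partial_scalar_cderiv[OF scalar_cderiv_component])
qed

text \<open>By the chain rule the determinants of \<open>h\<close> and \<open>H\<close> multiply to
  that of the identity matrix.\<close>

lemma det_jacobian_left_inverse:
  fixes h H :: "complex^'n::finite \<Rightarrow> complex^'n"
  assumes "bij_betw ix {..<CARD('n)} UNIV" "cdiff h z" "cdiff H (h z)" "\<forall>\<^sub>F w in nhds z. H (h w) = w"
  shows "det (jacobian ix h z) \<noteq> 0"
  using det_jacobian_compose[OF assms(1-3)] jacobian_local_id[OF assms(1,4)] by auto

section \<open>Solution curves\<close>

text \<open>A nonzero kernel vector of \<open>D\<close>, listed in the order of \<open>ix\<close>,
  would be a nonzero kernel vector of the Jacobian matrix and force its determinant to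
  vanish.\<close>

lemma inj_cderiv:
  fixes g :: "complex^'n::finite \<Rightarrow> complex^'n"
  assumes ix: "bij_betw ix {..<CARD('n)} UNIV" and g: "cderiv g D z" and "det (jacobian ix g z) \<noteq> 0"
  shows "inj D"
proof -
  have lin: "linear D" using g by (auto simp: cderiv_def intro: has_derivative_linear)
  have "v = 0" if v: "D v = 0" for v
  proof (rule ccontr)
    assume "v \<noteq> 0"
    then obtain k where "v $ k \<noteq> 0" by (auto simp: Finite_Cartesian_Product.vec_eq_iff)
    moreover have "k \<in> ix ` {..<CARD('n)}" using bij_betw_imp_surj_on[OF ix] by simp
    ultimately obtain j where j: "j < CARD('n)" "v $ ix j \<noteq> 0" by auto
    define w where "w = Matrix.vec CARD('n) (\<lambda>j. v $ ix j)"
    have "jacobian ix g z *\<^sub>v w = 0\<^sub>v CARD('n)"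
    proof (rule eq_vecI)
      fix i assume "i < dim_vec (0\<^sub>v CARD('n) :: complex Matrix.vec)"
      then have i: "i < CARD('n)" by simp
      have "(\<Sum>j<CARD('n). jacobian ix g z $$ (i, j) * v $ ix j) = 0"
        using cderiv_jacobian[OF ix g i, of v] v by simp
      then show "Matrix.vec_index (jacobian ix g z *\<^sub>v w) i = Matrix.vec_index (0\<^sub>v CARD('n)) i"
        using i by (simp add: w_def Matrix.scalar_prod_def jacobian_def atLeast0LessThan)
    qed (simp add: jacobian_def)
    moreover have "w \<noteq> 0\<^sub>v CARD('n)"
    proof
      assume "w = 0\<^sub>v CARD('n)"
      then have "Matrix.vec_index w j = 0" using j(1) by simp
      then show False using j by (simp add: w_def)
    qed
    moreover have "w \<in> carrier_vec CARD('n)" by (simp add: w_def)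
    ultimately show False
      using assms(3) det_0_iff_vec_prod_zero_field[OF jacobian_carrier[of ix g z]] by blast
  qed
  then show ?thesis using linear_injective_0[OF lin] by blast
qed

text \<open>Since \<open>q\<close> is continuous and \<open>D\<close> is bounded below, the linearization error
  \<open>o(|q s - q r|)\<close> of \<open>g\<close> is \<open>o(|s - r|)\<close>.\<close>

lemma has_derivative_solution_curve:
  fixes g :: "'a::euclidean_space \<Rightarrow> 'b::euclidean_space" and q :: "'c::real_normed_vector \<Rightarrow> 'a"
  assumes g: "(g has_derivative D) (at (q r))" and inj: "inj D"
    and q: "continuous (at r within R) q"
    and eq: "\<And>s. s \<in> R \<Longrightarrow> g (q s) = b s" and r: "r \<in> R"
    and b: "(b has_derivative (\<lambda>t. D (v t))) (at r within R)" and v: "bounded_linear v"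
  shows "(q has_derivative v) (at r within R)"
proof -
  have D: "linear D" using g by (rule has_derivative_linear)
  obtain B where B: "B > 0" "\<And>x. B * norm x \<le> norm (D x)"
    using linear_inj_bounded_below_pos[OF D inj] by metis
  obtain K where K: "K > 0" "\<And>t. norm (v t) \<le> norm t * K"
    using bounded_linear.pos_bounded[OF v] by blast
  show ?thesis
    unfolding has_derivative_within_alt2
  proof (intro conjI allI impI v)
    fix e :: real assume e: "e > 0"
    \<comment> \<open>The errors are estimated twice. The bounds \<open>B / 2\<close> give a crude
      linear bound of \<open>M\<close> by \<open>N\<close>; with it, the bounds containing
      \<open>e\<close> make the two errors at most \<open>B * e / 2 * N\<close> and
      \<open>B * e / 4 * N\<close>, which stays below \<open>B * e * N\<close>.\<close>
    define \<delta> where "\<delta> = min (B / 2) (B * e / (2 * (2 * K + 2)))"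
    define c where "c = min (B / 2) (B * e / 4)"
    have d: "\<delta> > 0" using B K e by (simp add: \<delta>_def)
    have "\<forall>\<^sub>F y in nhds (q r). norm (g y - g (q r) - D (y - q r)) \<le> \<delta> * norm (y - q r)"
    proof -
      have "\<forall>\<^sub>F y in at (q r). norm (g y - g (q r) - D (y - q r)) \<le> \<delta> * norm (y - q r)"
        using g d unfolding has_derivative_within_alt2 by blast
      \<comment> \<open>The estimate is trivial at \<open>q r\<close> itself. This point has to be
        included, since \<open>q s\<close> may equal \<open>q r\<close> for \<open>s\<close>
        different from \<open>r\<close>.\<close>
      then show ?thesis
        unfolding eventually_at_filter by (rule eventually_mono) (use linear_0[OF D] in auto)
    qed
    then have 1: "\<forall>\<^sub>F s in at r within R. norm (g (q s) - g (q r) - D (q s - q r)) \<le> \<delta> * norm (q s - q r)"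
      using q eventually_compose_filterlim unfolding continuous_within by blast
    have "c > 0" using B e by (simp add: c_def)
    then have 2: "\<forall>\<^sub>F s in at r within R. norm (b s - b r - D (v (s - r))) \<le> c * norm (s - r)"
      using b unfolding has_derivative_within_alt2 by blast
    have 3: "\<forall>\<^sub>F s in at r within R. s \<in> R" by (simp add: eventually_at_filter)
    show "\<forall>\<^sub>F s in at r within R. norm (q s - q r - v (s - r)) \<le> e * norm (s - r)"
      using 1 2 3
    proof eventually_elim
      case (elim s)
      define w where "w = q s - q r - v (s - r)"
      define N where "N = norm (s - r)"
      define M where "M = norm (q s - q r)"
      \<comment> \<open>Since \<open>g (q s) = b s\<close>, the increments of \<open>g\<close> along
        \<open>q\<close> and of \<open>b\<close> cancel, and only the two linearization errors
        remain.\<close>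
      have "D w = (b s - b r - D (v (s - r))) - (g (q s) - g (q r) - D (q s - q r))"
        using eq r elim(3) by (simp add: w_def linear_diff[OF D])
      then have "norm (D w) \<le> c * N + \<delta> * M"
        using norm_triangle_le_diff[OF add_mono[OF elim(2,1)]] unfolding N_def M_def by simp
      then have w: "B * norm w \<le> c * N + \<delta> * M"
        using B(2)[of w] by linarith
      have N: "N \<ge> 0" "M \<ge> 0" by (auto simp: N_def M_def)
      have "M \<le> norm w + norm (v (s - r))"
        using norm_triangle_ineq[of w "v (s - r)"] by (simp add: w_def M_def)
      then have M: "M \<le> norm w + K * N" using K(2)[of "s - r"] by (simp add: N_def mult.commute)
      \<comment> \<open>First pass: bounding \<open>M\<close> by \<open>norm w + K * N\<close>
        leaves \<open>norm w\<close> on the right with factor \<open>B / 2\<close>, which the left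
        side absorbs.\<close>
      have "B * norm w \<le> B / 2 * N + B / 2 * M"
      proof -
        have "c \<le> B / 2" "\<delta> \<le> B / 2" unfolding c_def \<delta>_def by linarith+
        from mult_right_mono[OF this(1) N(1)] mult_right_mono[OF this(2) N(2)] w
        show ?thesis by linarith
      qed
      also have "\<dots> \<le> B / 2 * N + B / 2 * (norm w + K * N)"
        using M B by simp
      finally have "B * (norm w) \<le> B * (N + K * N)" by (simp add: algebra_simps)
      then have "norm w \<le> N + K * N" using B by simp
      then have M': "M \<le> (2 * K + 1) * N" using M by (simp add: algebra_simps)
      \<comment> \<open>Second pass: now that \<open>M\<close> is at most a constant multiple of
        \<open>N\<close>, the error of \<open>g\<close> is small relative to
        \<open>N\<close>.\<close>
      have "\<delta> * M \<le> (B * e / (2 * (2 * K + 2))) * ((2 * K + 2) * N)"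
      proof (rule mult_mono)
        show "M \<le> (2 * K + 2) * N" using M' N by (simp add: algebra_simps)
      qed (use B K e N in \<open>auto simp: \<delta>_def\<close>)
      also have "\<dots> = B * e / 2 * N" using K by (simp add: field_simps)
      finally have "\<delta> * M \<le> B * e / 2 * N" .
      have "B * norm w \<le> B * e / 4 * N + B * e / 2 * N"
      proof -
        have "c \<le> B * e / 4" unfolding c_def by linarith
        from mult_right_mono[OF this N(1)] w \<open>\<delta> * M \<le> B * e / 2 * N\<close> show ?thesis by linarith
      qed
      also have "\<dots> \<le> B * (e * N)" using B e N by (simp add: algebra_simps)
      finally show ?case using B by (simp add: w_def N_def)
    qed
  qed
qed

section \<open>The coordinates near the divisor\<close>

lemma closed_poly_zeros:
  assumes "poly_fun P"
  shows "closed {z. P z = 0}"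
proof -
  have "isCont P z" for z
    using scalar_cdiff_poly[OF assms, of z]
    by (auto simp: scalar_cderiv_def intro: has_derivative_continuous)
  then have "continuous_on UNIV P" by (simp add: continuous_at_imp_continuous_on)
  then show ?thesis by (intro closed_Collect_eq continuous_on_const)
qed

lemma closed_zariski_closed:
  fixes S :: "(complex^'n::finite) set"
  assumes "zariski_closed S"
  shows "closed S"
proof -
  obtain I where I: "\<forall>P\<in>I. poly_fun P" "S = {z. \<forall>P\<in>I. P z = 0}"
    using assms unfolding zariski_closed_def by blast
  then have "S = (\<Inter>P\<in>I. {z. P z = 0})" by auto
  then show ?thesis using I(1) closed_poly_zeros by auto
qed

lemma open_polydisc: "open (polydisc \<epsilon> :: (complex^'n::finite) set)"
proof -
  have "polydisc \<epsilon> = (\<Inter>k. {w :: complex^'n. norm (w $ k) < \<epsilon>})" by (auto simp: polydisc_def)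
  then show ?thesis by (auto intro!: open_INT open_Collect_less continuous_intros)
qed

lemma invert_last_last: "invert_last ix q $ last_ix ix = inverse (q $ last_ix ix)"
  by (simp add: invert_last_def)

lemma invert_last_invert_last: "invert_last ix (invert_last ix q) = q"
  by (simp add: invert_last_def Finite_Cartesian_Product.vec_eq_iff)

lemma cdiff_invert_last:
  fixes q :: "complex^'n::finite"
  assumes "q $ last_ix ix \<noteq> 0"
  shows "cdiff (invert_last ix) q"
proof (rule cdiff_componentwise)
  fix k
  show "scalar_cdiff (\<lambda>z. invert_last ix z $ k) q"
    using assms scalar_cdiff_inverse[OF scalar_cdiff_coord[of "last_ix ix"]] scalar_cdiff_coord[of k]
    by (cases "k = last_ix ix") (simp_all add: invert_last_def)
qed

lemma openin_classical_top_subset: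
  assumes "variety X A" "openin (classical_top X A) W"
  shows "W \<subseteq> X"
  using assms openin_classical_top by blast

text \<open>Zariski closed sets are classically closed; hence lying in a Zariski open set persists
  on a classical neighbourhood in the chart.\<close>

lemma closed_chart_minus_zariski_open:
  assumes "variety X A" "openin (zariski_top X A) W" "(U, \<phi>) \<in> A"
  shows "closed (\<phi> ` (U - W))"
  using assms openin_zariski_top[OF assms(1)] by (fastforce intro: closed_zariski_closed)

text \<open>Off \<open>\<Gamma>\<close>, the modification \<open>\<pi>\<close> is locally biregular, so both the map from the parameters
  \<open>\<tau>\<close> to the affine coordinates and its local inverse are rational in a chart of \<open>X\<close>, hence
  holomorphic.\<close>

lemma ug_representation_local_inverse:
  fixes x :: "complex^'n::finite \<Rightarrow> complex^'n" and A :: "('a, 'k::finite) atlas"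
  assumes modification: "smooth_modification X A \<pi>"
    and representation: "ug_representation ix X A \<pi> \<Gamma> e m \<epsilon> x"
    and z: "z \<in> ug_domain ix \<epsilon>"
  shows "cdiff x z \<and> (\<exists>H. cdiff H (x z) \<and> (\<forall>\<^sub>F w in nhds z. H (x w) = w))"
proof -
  have var: "variety X A" and regular: "regular_map A X proj_atlas \<pi>"
    using modification unfolding smooth_modification_def by auto
  obtain N \<tau> where m: "m \<ge> 1" and N: "openin (classical_top X A) N"
    and exc: "N \<inter> exceptional_locus X A proj_space proj_atlas \<pi> \<subseteq> \<Gamma>"
    and bihol: "biholomorphic A N affine_atlas (polydisc \<epsilon>) \<tau>"
    and \<Gamma>: "N \<inter> \<Gamma> = {p \<in> N. \<tau> p $ last_ix ix = 0}"
    and order: "\<And>p. p \<in> N \<Longrightarrow> homog (\<pi> p) $ Some (ix 0) \<noteq> 0 \<and>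
      (\<tau> p $ last_ix ix) ^ m = homog (\<pi> p) $ None / homog (\<pi> p) $ Some (ix 0)"
    and x: "\<And>p. p \<in> N \<Longrightarrow> p \<notin> \<Gamma> \<Longrightarrow> x (invert_last ix (\<tau> p)) = affine_part (\<pi> p)"
    using representation unfolding ug_representation_def by (elim conjE exE) blast
  define \<sigma> where "\<sigma> = the_inv_into N \<tau>"
  have bij: "bij_betw \<tau> N (polydisc \<epsilon>)"
    and hol: "holomorphic_map A N affine_atlas (polydisc \<epsilon>) \<tau>"
      "holomorphic_map affine_atlas (polydisc \<epsilon>) A N \<sigma>"
    using bihol unfolding biholomorphic_def \<sigma>_def by auto
  have \<sigma>: "\<sigma> w \<in> N" "\<tau> (\<sigma> w) = w" if "w \<in> polydisc \<epsilon>" for w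
    using bij that unfolding \<sigma>_def bij_betw_def
    by (auto intro: the_inv_into_into f_the_inv_into_f)
  \<comment> \<open>\<open>w0\<close> is \<open>z\<close> rewritten in the parameters with
    \<open>u\<close> inverted. Its last entry is nonzero, so the corresponding point
    \<open>p\<close> lies off \<open>\<Gamma>\<close>.\<close>
  define w0 where "w0 = invert_last ix z"
  have w0: "w0 \<in> polydisc \<epsilon>" "w0 $ last_ix ix \<noteq> 0" and z0: "z $ last_ix ix \<noteq> 0"
    using z invert_last_last[of ix z] by (simp_all add: w0_def ug_domain_def)
  define p where "p = \<sigma> w0"
  have p: "p \<in> N" "\<tau> p = w0" using \<sigma>[OF w0(1)] by (auto simp: p_def)
  have "p \<notin> \<Gamma>" using p w0(2) \<Gamma> by auto
  have NX: "N \<subseteq> X" by (rule openin_classical_top_subset[OF var N])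
  then have "p \<in> X" using p by blast
  then obtain U \<phi> where U: "(U, \<phi>) \<in> A" "p \<in> U"
    using var unfolding variety_def by auto
  have \<phi>: "inj_on \<phi> U" using var U(1) unfolding variety_def by auto
  have aff: "(UNIV, \<lambda>z. z) \<in> (affine_atlas :: (complex^'n, 'n) atlas)" by (simp add: affine_atlas_def)
  \<comment> \<open>\<open>G1\<close> and \<open>G2\<close> express the passage from the parameters
    to the chart \<open>\<phi>\<close> and back.\<close>
  obtain S1 G1 where G1: "w0 \<in> S1" "holo_on S1 G1"
    and G1': "\<And>w. w \<in> polydisc \<epsilon> \<Longrightarrow> w \<in> S1 \<Longrightarrow> \<sigma> w \<in> U \<and> \<phi> (\<sigma> w) = G1 w"
    using hol(2)[unfolded holomorphic_map_def] w0(1) aff U unfolding p_def by fastforce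
  obtain S2 G2 where G2: "\<phi> p \<in> S2" "holo_on S2 G2"
    and G2': "\<And>y. y \<in> N \<Longrightarrow> y \<in> U \<Longrightarrow> \<phi> y \<in> S2 \<Longrightarrow> \<tau> y = G2 (\<phi> y)"
    using hol(1)[unfolded holomorphic_map_def] p(1) aff U by fastforce
  define V where "V = {l \<in> proj_space :: 'n line set. homog l $ None \<noteq> 0}"
  have V: "(V, affine_part) \<in> proj_atlas" by (simp add: V_def proj_atlas_def)
  \<comment> \<open>A power of the nonzero last parameter is the quotient of the homogeneous
    coordinates \<open>None\<close> and \<open>Some (ix 0)\<close>, so \<open>\<pi> p\<close> is a
    point of affine space.\<close>
  have "homog (\<pi> p) $ None \<noteq> 0"
    using order[OF p(1)] w0(2) m by (auto simp: p(2))
  moreover have "\<pi> p \<in> proj_space"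
    using regular \<open>p \<in> X\<close> unfolding regular_map_def proj_atlas_def
    by fastforce
  ultimately have "\<pi> p \<in> V" by (simp add: V_def)
  obtain P Q where P: "\<And>k. poly_fun (P k)" and Q: "poly_fun Q" "Q (\<phi> p) \<noteq> 0"
    and PQ: "\<And>y. y \<in> X \<Longrightarrow> y \<in> U \<Longrightarrow> Q (\<phi> y) \<noteq> 0 \<Longrightarrow>
      \<pi> y \<in> V \<and> affine_part (\<pi> y) = (\<chi> k. P k (\<phi> y) / Q (\<phi> y))"
    using regular[unfolded regular_map_def] \<open>p \<in> X\<close> U V \<open>\<pi> p \<in> V\<close> by fastforce
  \<comment> \<open>This is where genericity of \<open>e\<close> enters: off \<open>\<Gamma>\<close>
    it provides a Zariski open \<open>D\<close> around \<open>p\<close> on which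
    \<open>\<pi>\<close> has a regular inverse \<open>h\<close>.\<close>
  have "p \<notin> exceptional_locus X A proj_space proj_atlas \<pi>" using exc p \<open>p \<notin> \<Gamma>\<close> by blast
  then obtain D E where "p \<in> D" and bireg: "biregular X A proj_space proj_atlas D E \<pi>"
    unfolding exceptional_locus_def using \<open>p \<in> X\<close> by blast
  define h where "h = the_inv_into D \<pi>"
  have D: "openin (zariski_top X A) D" and DE: "bij_betw \<pi> D E"
    and reg_h: "regular_map proj_atlas E A h"
    using bireg unfolding biregular_def h_def by auto
  have h: "h (\<pi> y) = y" if "y \<in> D" for y
    using DE that unfolding bij_betw_def h_def by (auto intro: the_inv_into_f_f)
  have "\<pi> p \<in> E" using DE \<open>p \<in> D\<close> by (auto simp: bij_betw_def)
  then obtain P' Q' where P': "\<And>k. poly_fun (P' k)"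
    and Q': "poly_fun Q'" "Q' (affine_part (\<pi> p)) \<noteq> 0"
    and PQ': "\<And>l. l \<in> E \<Longrightarrow> l \<in> V \<Longrightarrow> Q' (affine_part l) \<noteq> 0 \<Longrightarrow>
      h l \<in> U \<and> \<phi> (h l) = (\<chi> k. P' k (affine_part l) / Q' (affine_part l))"
    using reg_h[unfolded regular_map_def] U V \<open>\<pi> p \<in> V\<close> h[OF \<open>p \<in> D\<close>] by fastforce

  \<comment> \<open>\<open>a\<close> is \<open>\<pi>\<close> read from the parameters to affine
    coordinates, and \<open>b\<close> is \<open>h\<close> read from affine coordinates to the chart
    \<open>\<phi>\<close>.\<close>
  define a where "a w = (\<chi> k. P k (G1 w) / Q (G1 w))" for w
  define b where "b y = (\<chi> k. P' k y / Q' y)" for y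
  have G1p: "G1 w0 = \<phi> p" using G1'[OF w0(1) G1(1)] by (simp add: p_def)
  have ap: "affine_part (\<pi> p) = a w0" using PQ[OF \<open>p \<in> X\<close> U(2) Q(2)] by (simp add: a_def G1p)
  have dG1: "cdiff G1 w0" using holo_on_cdiff G1 by blast
  have da: "cdiff a w0"
    unfolding a_def
    by (rule cdiff_compose[OF dG1]) (use cdiff_poly_quotient P Q G1p in auto)
  have db: "cdiff b (a w0)"
    unfolding b_def using cdiff_poly_quotient P' Q' ap by auto
  have closed: "closed (\<phi> ` (U - D))"
    by (rule closed_chart_minus_zariski_open[OF var D U(1)])
  have "\<phi> p \<notin> \<phi> ` (U - D)" using \<phi> U(2) \<open>p \<in> D\<close> by (auto dest: inj_onD)

  have G1_tendsto: "filterlim G1 (nhds (\<phi> p)) (nhds w0)"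
    using cdiff_tendsto[OF dG1] by (simp add: G1p)
  have a_tendsto: "filterlim a (nhds (a w0)) (nhds w0)" using da by (rule cdiff_tendsto)
  \<comment> \<open>Every condition under which these local formulas hold is open, so all of them
    hold together near \<open>w0\<close>.\<close>
  have ev: "\<forall>\<^sub>F w in nhds w0. w \<in> polydisc \<epsilon>" "\<forall>\<^sub>F w in nhds w0. w \<in> S1"
    "\<forall>\<^sub>F w in nhds w0. G1 w \<in> S2" "\<forall>\<^sub>F w in nhds w0. G1 w \<notin> \<phi> ` (U - D)"
    "\<forall>\<^sub>F w in nhds w0. Q (G1 w) \<noteq> 0" "\<forall>\<^sub>F w in nhds w0. Q' (a w) \<noteq> 0"
  proof -
    show "\<forall>\<^sub>F w in nhds w0. w \<in> polydisc \<epsilon>" using open_polydisc w0(1) by (rule eventually_nhds_in_open)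
    show "\<forall>\<^sub>F w in nhds w0. w \<in> S1" using G1 by (auto simp: holo_on_def intro: eventually_nhds_in_open)
    show "\<forall>\<^sub>F w in nhds w0. G1 w \<in> S2"
      using topological_tendstoD[OF G1_tendsto] G2 by (auto simp: holo_on_def)
    show "\<forall>\<^sub>F w in nhds w0. G1 w \<notin> \<phi> ` (U - D)"
      using topological_tendstoD[OF G1_tendsto open_Compl[OF closed]] \<open>\<phi> p \<notin> \<phi> ` (U - D)\<close> by simp
    from topological_tendstoD[OF G1_tendsto open_Compl[OF closed_poly_zeros[OF Q(1)]]]
      topological_tendstoD[OF a_tendsto open_Compl[OF closed_poly_zeros[OF Q'(1)]]]
    show "\<forall>\<^sub>F w in nhds w0. Q (G1 w) \<noteq> 0" "\<forall>\<^sub>F w in nhds w0. Q' (a w) \<noteq> 0"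
      using Q(2) Q'(2) ap by auto
  qed
  have loc: "\<forall>\<^sub>F w in nhds w0. w \<in> polydisc \<epsilon> \<and> affine_part (\<pi> (\<sigma> w)) = a w \<and> G2 (b (a w)) = w"
    using ev
  proof eventually_elim
    case (elim w)
    have s: "\<sigma> w \<in> N" "\<tau> (\<sigma> w) = w" "\<sigma> w \<in> U" "\<phi> (\<sigma> w) = G1 w"
      using \<sigma>[OF elim(1)] G1'[OF elim(1,2)] by auto
    have sX: "\<sigma> w \<in> X" using s NX by blast
    have pi: "\<pi> (\<sigma> w) \<in> V" "affine_part (\<pi> (\<sigma> w)) = a w"
      using PQ[OF sX s(3)] elim(5) s(4) by (auto simp: a_def)
    have "\<sigma> w \<in> D" using elim(4) s(3,4) by (metis DiffI imageI)
    then have "\<pi> (\<sigma> w) \<in> E" "h (\<pi> (\<sigma> w)) = \<sigma> w" using DE h by (auto simp: bij_betw_def)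
    \<comment> \<open>Applying \<open>h\<close> to \<open>\<pi> (\<sigma> w)\<close> recovers the
      chart point of \<open>\<sigma> w\<close>, from which \<open>G2\<close> recovers the parameters
      \<open>w\<close>.\<close>
    then have "G1 w = b (a w)" using PQ'[of "\<pi> (\<sigma> w)"] pi elim(6) s(4) by (simp add: b_def)
    then show ?case using G2'[of "\<sigma> w"] s elim(1,3) pi(2) by simp
  qed
  \<comment> \<open>\<open>b (a w0)\<close> is the chart point \<open>\<phi> p\<close>, at which
    \<open>G2\<close> is holomorphic.\<close>
  have dG2: "cdiff G2 (b (a w0))" and inv: "G2 (b (a w0)) = w0"
  proof -
    have "G1 w0 = b (a w0)"
      using PQ'[OF \<open>\<pi> p \<in> E\<close> \<open>\<pi> p \<in> V\<close> Q'(2)] h[OF \<open>p \<in> D\<close>] ap by (simp add: b_def G1p)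
    then show "cdiff G2 (b (a w0))" using holo_on_cdiff G2 G1p by metis
    show "G2 (b (a w0)) = w0" using eventually_nhds_x_imp_x[OF loc] by simp
  qed
  have dinv: "cdiff (invert_last ix) z" "cdiff (invert_last ix) w0"
    using cdiff_invert_last z0 w0 by blast+
  have "filterlim (invert_last ix) (nhds w0) (nhds z)"
    using cdiff_tendsto[OF dinv(1)] by (simp add: w0_def)
  from eventually_compose_filterlim[OF loc this]
  have loc': "\<forall>\<^sub>F w in nhds z. invert_last ix w \<in> polydisc \<epsilon> \<and>
      affine_part (\<pi> (\<sigma> (invert_last ix w))) = a (invert_last ix w) \<and>
      G2 (b (a (invert_last ix w))) = invert_last ix w" .
  have "open {w :: complex^'n. w $ last_ix ix \<noteq> 0}"
    by (intro open_Collect_neq continuous_intros)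
  from eventually_nhds_in_open[OF this, of z]
  have ne: "\<forall>\<^sub>F w in nhds z. w $ last_ix ix \<noteq> 0" using z0 by simp
  \<comment> \<open>The value \<open>x w\<close> is read off at the point
    \<open>\<sigma> (invert_last ix w)\<close>, which avoids \<open>\<Gamma>\<close> because its
    last parameter is the inverse of a nonzero \<open>u\<close>.\<close>
  have xa: "\<forall>\<^sub>F w in nhds z. x w = a (invert_last ix w)"
    using loc' ne
  proof eventually_elim
    case (elim w)
    then have s: "\<sigma> (invert_last ix w) \<in> N" "\<tau> (\<sigma> (invert_last ix w)) = invert_last ix w"
      using \<sigma> by auto
    have "\<sigma> (invert_last ix w) \<notin> \<Gamma>"
    proof
      assume "\<sigma> (invert_last ix w) \<in> \<Gamma>"
      then have "\<sigma> (invert_last ix w) \<in> {p \<in> N. \<tau> p $ last_ix ix = 0}"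
        using s(1) \<Gamma> by blast
      then show False using s(2) elim(2) by (simp add: invert_last_def)
    qed
    from x[OF s(1) this] show ?case using elim(1) s(2) by (simp add: invert_last_invert_last)
  qed
  have "cdiff (\<lambda>w. a (invert_last ix w)) z"
    using cdiff_compose[OF dinv(1)] da by (simp add: w0_def)
  then have "cdiff x z" using cderiv_transform xa by blast
  \<comment> \<open>The local inverse goes back from affine coordinates to the chart by
    \<open>b\<close>, to the parameters by \<open>G2\<close>, and to \<gamma> and u by
    \<open>invert_last\<close>.\<close>
  moreover have "cdiff (\<lambda>y. invert_last ix (G2 (b y))) (x z)"
  proof -
    have "x z = a w0" using eventually_nhds_x_imp_x[OF xa] by (simp add: w0_def)
    then show ?thesis
      using cdiff_compose[OF cdiff_compose[OF db dG2], of "invert_last ix"] dinv(2) inv by simp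
  qed
  moreover have "\<forall>\<^sub>F w in nhds z. invert_last ix (G2 (b (x w))) = w"
    using loc' xa by eventually_elim (simp add: invert_last_invert_last)
  ultimately show ?thesis by blast
qed

section \<open>Velocities along a trajectory by Cramer's rule\<close>

theorem theorem28:
  fixes ix :: "nat \<Rightarrow> 'n::finite"
    and f :: "complex^'n \<Rightarrow> complex^'n"
    and V :: "(complex^'n) set"
    and X :: "'a set"
    and A :: "('a, 'k::finite) atlas"
    and \<pi> :: "'a \<Rightarrow> 'n line"
    and \<Gamma> D :: "'a set"
    and F :: "'a \<Rightarrow> complex^'n"
    and e :: 'a
    and m :: nat
    and \<epsilon> :: real
    and x :: "complex^'n \<Rightarrow> complex^'n"
    and i :: nat
    and R :: "complex set"
    and q :: "complex \<Rightarrow> complex^'n"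
    and r :: complex
  defines "n \<equiv> CARD('n)"
    and "fhat \<equiv> f \<circ> x"
  assumes ix: "bij_betw ix {..<n} UNIV"
    and keller: "keller_map ix f"
    and V: "codim_one_component (finiteness_variety f) V"
    and modification: "smooth_modification X A \<pi>"
    and divisor: "prime_divisor (zariski_top X A) \<Gamma>"
    and at_infinity: "\<pi> ` \<Gamma> \<subseteq> hyperplane_at_infinity"
    and extension: "extends_over_divisor f X A \<pi> \<Gamma> V D F"
    and e: "e \<in> \<Gamma> \<inter> D" "F e = 0"
    and representation: "ug_representation ix X A \<pi> \<Gamma> e m \<epsilon> x"
    and i: "i < n"
    and trajectory: "trajectory fhat (ug_domain ix \<epsilon>) (ix i) R q"
    and r: "r \<in> R"
  defines "J \<equiv> jacobian ix fhat (q r)"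
  defines "L \<equiv> det J"
  shows "L \<noteq> 0 \<and>
    (\<exists>d\<gamma> du.
       (\<forall>j<n - 1. ((\<lambda>s. q s $ ix j) has_field_derivative d\<gamma> j) (at r within R)) \<and>
       ((\<lambda>s. q s $ ix (n - 1)) has_field_derivative du) (at r within R) \<and>
       (\<Sum>j<n - 1. partial (\<lambda>w. fhat w $ ix i) (ix j) (q r) * d\<gamma> j)
         + partial (\<lambda>w. fhat w $ ix i) (ix (n - 1)) (q r) * du = 1 \<and>
       (\<forall>j<n - 1. d\<gamma> j = inverse L * cofactor J i j) \<and>
       du = inverse L * cofactor J i (n - 1))"
proof -
  have ix': "bij_betw ix {..<CARD('n)} UNIV" using ix by (simp add: n_def)
  have tr: "continuous_on R q" "q s \<in> ug_domain ix \<epsilon>" "fhat (q s) = (\<chi> l. if l = ix i then s else 0)"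
    if "s \<in> R" for s
    using trajectory that by (auto simp: trajectory_def Finite_Cartesian_Product.vec_eq_iff)
  obtain H where x: "cdiff x (q r)" and H: "cdiff H (x (q r))" "\<forall>\<^sub>F w in nhds (q r). H (x w) = w"
    using ug_representation_local_inverse[OF modification representation tr(2)[OF r]] by blast
  have f: "cdiff f (x (q r))" "det (jacobian ix f (x (q r))) = 1"
    using keller cdiff_poly unfolding keller_map_def by blast+
  obtain T where T: "cderiv fhat T (q r)"
    using cdiff_compose[OF x f(1)] unfolding fhat_def comp_def by blast
  have "L = det (jacobian ix x (q r))"
    unfolding L_def J_def fhat_def comp_def det_jacobian_compose[OF ix' x f(1)] f(2) by simp
  then have L: "L \<noteq> 0" using det_jacobian_left_inverse[OF ix' x H] by simp

  have J: "J \<in> carrier_mat n n" unfolding J_def n_def by (rule jacobian_carrier)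
  define N where "N k = the_inv_into {..<n} ix k" for k
  have N: "N (ix j) = j" if "j < n" for j
    using ix that by (simp add: N_def bij_betw_def the_inv_into_f_f)
  \<comment> \<open>The candidate velocity is the \<open>i\<close>-th column of the inverse of
    \<open>J\<close>, written by cofactors; \<open>N\<close> converts a coordinate back to its
    number.\<close>
  define v :: "complex^'n" where "v = (\<chi> k. inverse L * cofactor J i (N k))"
  have v: "v $ ix j = inverse L * cofactor J i j" if "j < n" for j
    using N[OF that] by (simp add: v_def)
  have Jv: "(\<Sum>j<n. J $$ (l, j) * v $ ix j) = (if l = i then 1 else 0)" if l: "l < n" for l
  proof -
    have "(\<Sum>j<n. J $$ (l, j) * v $ ix j) = inverse L * (\<Sum>j<n. J $$ (l, j) * cofactor J i j)"
      unfolding sum_distrib_left by (rule sum.cong) (simp_all add: v)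
    \<comment> \<open>Pairing row \<open>l\<close> with the cofactors of row \<open>i\<close> gives
      an entry of \<open>J * adj_mat J\<close>, which is \<open>L\<close> times the identity
      matrix.\<close>
    also have "(\<Sum>j<n. J $$ (l, j) * cofactor J i j) = (J * adj_mat J) $$ (l, i)"
      using J l i by (simp add: times_mat_def Matrix.scalar_prod_def adj_mat_def atLeast0LessThan)
    also have "\<dots> = L * (if l = i then 1 else 0)"
      unfolding adj_mat(2)[OF J] using l i by (simp add: L_def)
    finally show ?thesis using L by simp
  qed
  have Tv: "T v = axis (ix i) 1"
  proof -
    have "T v $ k = axis (ix i) 1 $ k" for k
    proof -
      have "k \<in> ix ` {..<n}" using bij_betw_imp_surj_on[OF ix] by simp
      then obtain l where l: "l < n" "k = ix l" by blast
      then have "ix l = ix i \<longleftrightarrow> l = i" using N i by metis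
      then show ?thesis
        using cderiv_jacobian[OF ix' T, of l v] Jv[OF l(1)] l
        by (simp add: n_def J_def axis_def)
    qed
    then show ?thesis by (simp add: Finite_Cartesian_Product.vec_eq_iff)
  qed
  have T': "(fhat has_derivative T) (at (q r))" "\<And>c v. T (c *s v) = c *s T v"
    using T by (auto simp: cderiv_def)
  have v': "bounded_linear (\<lambda>t. t *s v)"
    unfolding linear_conv_bounded_linear[symmetric]
    by (rule linearI) (simp_all add: algebra_simps Finite_Cartesian_Product.vec_eq_iff)
  \<comment> \<open>The right-hand side is \<open>s\<close> times the \<open>i\<close>-th basis
    vector; its derivative factors through \<open>T\<close> because \<open>T v\<close> is that basis
    vector. Differentiability of \<open>q\<close> thus follows from its continuity.\<close>
  have q': "(q has_derivative (\<lambda>t. t *s v)) (at r within R)"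
  proof (rule has_derivative_solution_curve[where q = q and r = r and b = "\<lambda>s. \<chi> l. if l = ix i then s else 0", OF T'(1) _ _ _ r _ v'])
    show "inj T" using inj_cderiv[OF ix' T] L by (simp add: L_def J_def)
    show "fhat (q s) = (\<chi> l. if l = ix i then s else 0)" if "s \<in> R" for s using that by (rule tr(3))
    show "continuous (at r within R) q" using tr(1)[OF r] r by (simp add: continuous_on_eq_continuous_within)
    show "((\<lambda>s. \<chi> l. if l = ix i then s else 0) has_derivative (\<lambda>t. T (t *s v))) (at r within R)"
    proof -
      have "((\<lambda>s. \<chi> l. if l = ix i then s else 0) has_derivative (\<lambda>t. \<chi> l. if l = ix i then t else 0))
          (at r within R)"
      proof (rule has_derivative_vec_lambda)
        fix l
        show "((\<lambda>s. (\<chi> l. if l = ix i then s else 0) $ l) has_derivative (\<lambda>t. if l = ix i then t else 0))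
            (at r within R)"
          by (cases "l = ix i") auto
      qed
      moreover have "(\<chi> l. if l = ix i then t else 0) = T (t *s v)" for t
        unfolding T'(2) Tv by (simp add: axis_def Finite_Cartesian_Product.vec_eq_iff)
      ultimately show ?thesis by simp
    qed
  qed
  have dq: "((\<lambda>s. q s $ k) has_field_derivative v $ k) (at r within R)" for k
    using bounded_linear.has_derivative[OF bounded_linear_vec_nth q', of k]
    by (simp add: has_field_derivative_def mult.commute[of _ "v $ k"])
  \<comment> \<open>From \<open>i < n\<close>, \<open>n\<close> is positive, so the last column
    \<open>n - 1\<close>, which belongs to \<open>u\<close>, can be split off the sum.\<close>
  have n: "n = Suc (n - 1)" using i by simp
  have J': "J $$ (i, j) = partial (\<lambda>w. fhat w $ ix i) (ix j) (q r)" if "j < n" for j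
    using that i by (simp add: J_def jacobian_def n_def)
  have "(\<Sum>j<n - 1. partial (\<lambda>w. fhat w $ ix i) (ix j) (q r) * v $ ix j)
         + partial (\<lambda>w. fhat w $ ix i) (ix (n - 1)) (q r) * v $ ix (n - 1)
      = (\<Sum>j<n. partial (\<lambda>w. fhat w $ ix i) (ix j) (q r) * v $ ix j)"
    by (subst (3) n) simp
  also have "\<dots> = 1" using Jv[OF i] by (simp add: J')
  finally have sum: "(\<Sum>j<n - 1. partial (\<lambda>w. fhat w $ ix i) (ix j) (q r) * v $ ix j)
         + partial (\<lambda>w. fhat w $ ix i) (ix (n - 1)) (q r) * v $ ix (n - 1) = 1" .
  \<comment> \<open>The coordinates of \<open>v\<close> serve as the witnesses
    \<open>d\<gamma>\<close> and \<open>du\<close>.\<close>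
  show ?thesis
  proof (intro conjI exI allI impI)
    show "((\<lambda>s. q s $ ix j) has_field_derivative v $ ix j) (at r within R)" for j by (rule dq)
    show "((\<lambda>s. q s $ ix (n - 1)) has_field_derivative v $ ix (n - 1)) (at r within R)" by (rule dq)
    show "v $ ix j = inverse L * cofactor J i j" if "j < n - 1" for j using that by (simp add: v)
    show "v $ ix (n - 1) = inverse L * cofactor J i (n - 1)" using n by (simp add: v)
  qed (fact L sum)+
qed

end
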